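(* Let $\Omega\subset\mathbb{C}$ be an exceptional domain whose boundary $\partial\Omega$ is connected and is a proper arc, and let $u$ be its associated function. Then $|\nabla u|=1$ in $\Omega$, and $\Omega$ is a half-plane.
   Context: We identify $\mathbb{R}^2$ with $\mathbb{C}$. An open set $\Omega\subset\mathbb{C}$ with non-empty boundary is a smooth domain if, for each $z_0\in\partial\Omega$, there exist $\varepsilon>0$ and a smooth diffeomorphism $\psi$ from $D(z_0,\varepsilon)$ onto an open set $D\subset\mathbb{R}^2$ such that $\psi(D(z_0,\varepsilon)\cap\Omega)=D\cap\{x_2>0\}$ and $\psi(D(z_0,\varepsilon)\cap\partial\Omega)=D\cap\{x_2=0\}$. An exceptional domain is a smooth, connected, unbounded domain $\Omega\subset\mathbb{C}$ with non-empty boundary that admits a function $u$, harmonic in $\Omega$ and $C^1$ up to the boundary, such that $u>0$ in $\Omega$, $u=0$ on $\partial\Omega$, and $|\nabla u|=1$ on $\partial\Omega$. Such a $u$ is unique, and we call it the associated function of $\Omega$. A proper arc is the image of a smooth embedding $\gamma:\mathbb{R}\to\mathbb{C}$ such that $\lim_{t\to\pm\infty}|\gamma(t)|=\infty$. *)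

theory Defs
  imports "HOL-Analysis.Analysis"
begin

fun iter_dd :: "'a::real_normed_vector list \<Rightarrow> ('a \<Rightarrow> 'b::real_normed_vector) \<Rightarrow> 'a \<Rightarrow> 'b" where
  "iter_dd [] f = f"
| "iter_dd (v # vs) f = (\<lambda>x. frechet_derivative (iter_dd vs f) (at x) v)"

definition smooth_on :: "'a::real_normed_vector set \<Rightarrow> ('a \<Rightarrow> 'b::real_normed_vector) \<Rightarrow> bool" where
  "smooth_on S f \<longleftrightarrow> (\<forall>vs. iter_dd vs f differentiable_on S)"

definition smooth_diffeo :: "complex set \<Rightarrow> complex set \<Rightarrow> (complex \<Rightarrow> complex) \<Rightarrow> bool" where
  "smooth_diffeo U D \<psi> \<longleftrightarrow> open U \<and> open D \<and> \<psi> ` U = D \<and> inj_on \<psi> U \<and>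
     smooth_on U \<psi> \<and> smooth_on D (inv_into U \<psi>)"

definition smooth_domain :: "complex set \<Rightarrow> bool" where
  "smooth_domain \<Omega> \<longleftrightarrow> open \<Omega> \<and> frontier \<Omega> \<noteq> {} \<and>
     (\<forall>z0\<in>frontier \<Omega>. \<exists>\<epsilon>>0. \<exists>\<psi> D. smooth_diffeo (ball z0 \<epsilon>) D \<psi> \<and>
        \<psi> ` (ball z0 \<epsilon> \<inter> \<Omega>) = D \<inter> {w. Im w > 0} \<and>
        \<psi> ` (ball z0 \<epsilon> \<inter> frontier \<Omega>) = D \<inter> {w. Im w = 0})"

definition grad :: "(complex \<Rightarrow> real) \<Rightarrow> complex \<Rightarrow> complex" where
  "grad u z = Complex (iter_dd [1] u z) (iter_dd [\<i>] u z)"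

definition harmonic_on :: "complex set \<Rightarrow> (complex \<Rightarrow> real) \<Rightarrow> bool" where
  "harmonic_on \<Omega> u \<longleftrightarrow> open \<Omega> \<and> u differentiable_on \<Omega> \<and>
     (\<forall>v. iter_dd [v] u differentiable_on \<Omega>) \<and>
     (\<forall>v w. continuous_on \<Omega> (iter_dd [v, w] u)) \<and>
     (\<forall>z\<in>\<Omega>. iter_dd [1, 1] u z + iter_dd [\<i>, \<i>] u z = 0)"

definition assoc_fun :: "complex set \<Rightarrow> (complex \<Rightarrow> real) \<Rightarrow> bool" where
  "assoc_fun \<Omega> u \<longleftrightarrow> harmonic_on \<Omega> u \<and> continuous_on (closure \<Omega>) u \<and>
     (\<exists>G. continuous_on (closure \<Omega>) G \<and> (\<forall>z\<in>\<Omega>. G z = grad u z) \<and>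
          (\<forall>z\<in>frontier \<Omega>. norm (G z) = 1)) \<and>
     (\<forall>z\<in>\<Omega>. u z > 0) \<and> (\<forall>z\<in>frontier \<Omega>. u z = 0)"

definition exceptional_domain :: "complex set \<Rightarrow> bool" where
  "exceptional_domain \<Omega> \<longleftrightarrow> smooth_domain \<Omega> \<and> connected \<Omega> \<and> \<not> bounded \<Omega> \<and>
     frontier \<Omega> \<noteq> {} \<and> (\<exists>u. assoc_fun \<Omega> u)"

definition proper_arc :: "complex set \<Rightarrow> bool" where
  "proper_arc A \<longleftrightarrow> (\<exists>\<gamma>::real \<Rightarrow> complex. smooth_on UNIV \<gamma> \<and>
     (\<forall>t. vector_derivative \<gamma> (at t) \<noteq> 0) \<and>
     (\<exists>g. homeomorphism UNIV (range \<gamma>) \<gamma> g) \<and> range \<gamma> = A \<and>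
     filterlim (\<lambda>t. norm (\<gamma> t)) at_top at_top \<and>
     filterlim (\<lambda>t. norm (\<gamma> t)) at_top at_bot)"

definition half_plane :: "complex set \<Rightarrow> bool" where
  "half_plane H \<longleftrightarrow> (\<exists>a b. a \<noteq> 0 \<and> H = {z. inner a z > b})"

end

theory Submission
  imports Defs "HOL-Complex_Analysis.Complex_Analysis"
begin

text \<open>Since \<open>\<partial>\<Omega>\<close> is connected and unbounded, \<open>\<Omega>\<close> is simply connected, and \<open>u = Im F\<close> with
  \<open>F' = \<i> cnj (grad u)\<close>. Near the boundary \<open>\<bar>F'\<bar>\<close> tends to 1, so \<open>F\<close> straightens \<open>\<partial>\<Omega>\<close> locally and
  the Riemann map extends continuously to \<open>\<partial>\<Omega>\<close> by reflection. The image of \<open>\<partial>\<Omega>\<close> in the unit circle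
  is connected, and its complement carries the boundary value \<open>\<infinity>\<close>, so it contains no arc: it is a
  single point. This gives a conformal map \<open>\<Phi>\<close> from the upper half-plane onto \<open>\<Omega>\<close> with finite boundary
  values along the whole real line.

  A holomorphic function on the upper half-plane whose imaginary part is bounded below and vanishes on the
  real line is \<open>c w + d\<close> with \<open>c \<ge> 0\<close> and \<open>d\<close> real. Applied to \<open>F \<circ> \<Phi>\<close>, this gives
  \<open>F'(\<Phi>) \<Phi>' = a\<close> with \<open>a > 0\<close>; since \<open>\<bar>F'\<bar>\<close> is bounded and tends to 1 at the boundary, it applies
  again to \<open>\<i> log (\<Phi>' / a)\<close>. So \<open>\<Phi>' = a exp (- \<i> (c w + d))\<close>, and \<open>c = 0\<close>, as otherwise \<open>\<Phi>\<close> would be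
  periodic. Hence \<open>\<Phi>\<close> is affine.\<close>

section \<open>Schwarz--Pick estimates and boundary behaviour in the upper half-plane\<close>

text \<open>The difficulty is at the boundary, where only \<open>Im F\<close> and \<open>F'\<close>
  are controlled. Close to a boundary point \<open>p\<close>, \<open>F'\<close> is nearly the
  unimodular constant \<open>g p\<close>, so \<open>F\<close> is bi-Lipschitz there and covers a
  half-disc; \<open>F\<close> thus serves as the local coordinate in which the Riemann map is
  reflected. Reflection requires limits of the whole function, not of its imaginary part alone: a
  barrier turns zero boundary values into \<open>Im f = O(Im w)\<close>, so the derivative stays
  bounded and the function converges.

  The point missing from the image of the boundary is a cluster value \<open>b\<close> of the
  Riemann map along a sequence tending to infinity; a Cayley map moves it to infinity. Infinity
  cannot be the boundary value on a whole arc because some \<open>q\<close> lies outside the closure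
  of the domain: \<open>1 / (\<Phi> - q)\<close> would vanish on a real interval, hence identically.

  The factor \<open>\<i>\<close> before the logarithm makes \<open>- ln |F'(\<Phi>)|\<close> an
  imaginary part, so an upper bound for \<open>|F'|\<close> is exactly the lower bound that rigidity
  asks for.\<close>

lemma norm_diff_less_norm_diff_cnj:
  assumes "Im a > 0" "Im b > 0"
  shows "norm (a - b) < norm (a - cnj b)"
proof -
  have "(Im a - Im b)\<^sup>2 < (Im a + Im b)\<^sup>2"
    using mult_pos_pos[OF assms] by (simp add: power2_eq_square algebra_simps)
  then show ?thesis
    by (simp add: cmod_def)
qed

text \<open>The quotient \<open>(f - f 0) / (f - cnj (f 0))\<close> is \<open>f\<close> followed by
  the Moebius map of the half-plane onto the disc that sends \<open>f 0\<close> to 0, so the Schwarz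
  lemma applies to it.\<close>

lemma Schwarz_Pick_disc_half_plane:
  assumes holf: "f holomorphic_on ball 0 1"
    and pos: "\<And>w. norm w < 1 \<Longrightarrow> Im (f w) > 0" and w: "norm w < 1"
  shows "norm (f w - f 0) \<le> norm w * norm (f w - cnj (f 0))"
proof -
  have nz: "f z - cnj (f 0) \<noteq> 0" if "norm z < 1" for z
  proof -
    have "Im (f z - cnj (f 0)) > 0"
      using pos[OF that] pos[of 0] by simp
    then show ?thesis by force
  qed
  have "norm ((f w - f 0) / (f w - cnj (f 0))) \<le> norm w"
  proof (rule Schwarz_Lemma(1)[where f = "\<lambda>w. (f w - f 0) / (f w - cnj (f 0))"])
    show "(\<lambda>w. (f w - f 0) / (f w - cnj (f 0))) holomorphic_on ball 0 1"
      by (intro holomorphic_intros holf) (use nz in auto)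
    show "norm ((f z - f 0) / (f z - cnj (f 0))) < 1" if "norm z < 1" for z
      using norm_diff_less_norm_diff_cnj[OF pos[OF that] pos[of 0]] nz[OF that]
      by (simp add: norm_divide divide_less_eq)
  qed (use w in auto)
  then show ?thesis
    using nz[OF w] by (simp add: norm_divide divide_le_eq)
qed

lemma Schwarz_Pick_ball_half_plane:
  assumes holf: "f holomorphic_on ball z d"
    and pos: "\<And>w. w \<in> ball z d \<Longrightarrow> Im (f w) > 0" and w: "w \<in> ball z d"
  shows "d * norm (f w - f z) \<le> norm (w - z) * norm (f w - cnj (f z))"
proof -
  have d: "d > 0"
    using w by (metis ball_eq_empty empty_iff not_le)
  have in_ball: "z + of_real d * v \<in> ball z d" if "norm v < 1" for v
    using that d by (simp add: dist_norm norm_mult)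
  define v where "v = (w - z) / of_real d"
  have v: "norm v < 1" "z + of_real d * v = w" "norm v = norm (w - z) / d"
    using w d by (auto simp: v_def norm_divide dist_norm norm_minus_commute)
  have "norm (f (z + of_real d * v) - f (z + of_real d * 0))
      \<le> norm v * norm (f (z + of_real d * v) - cnj (f (z + of_real d * 0)))"
  proof (rule Schwarz_Pick_disc_half_plane)
    show "(\<lambda>v. f (z + of_real d * v)) holomorphic_on ball 0 1"
      by (rule holomorphic_on_compose_gen[OF _ holf, unfolded o_def])
        (use in_ball in \<open>auto intro!: holomorphic_intros\<close>)
  qed (use in_ball pos v in auto)
  then show ?thesis
    using d v by (simp add: field_simps)
qed

text \<open>The right-hand side is the Poisson kernel of the disc with pole 1, so its sign shows on
  which side of the circle \<open>w\<close> lies. At \<open>w = 1\<close> both sides are 0 by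
  division by zero, whence no side condition.\<close>

lemma Im_Cayley: "Im (\<i> * (1 + w) / (1 - w)) = (1 - (norm w)\<^sup>2) / (norm (1 - w))\<^sup>2"
  unfolding Im_divide cmod_power2 by (simp add: power2_eq_square algebra_simps)

lemma Schwarz_Pick_half_plane:
  assumes holf: "f holomorphic_on {w. Im w > 0}"
    and pos: "\<And>w. Im w > 0 \<Longrightarrow> Im (f w) > 0" and w: "Im w > 0"
  shows "norm (f w - f \<i>) * norm (w + \<i>) \<le> norm (w - \<i>) * norm (f w - cnj (f \<i>))"
proof -
  have nz: "1 - v \<noteq> 0" if "norm v < 1" for v :: complex
    using that by auto
  have Im_pos: "Im (\<i> * (1 + v) / (1 - v)) > 0" if "norm v < 1" for v
    using nz[OF that] that unfolding Im_Cayley by (simp add: power_less_one_iff)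
  define v where "v = (w - \<i>) / (w + \<i>)"
  have wi: "w + \<i> \<noteq> 0"
    using w by (metis add_eq_0_iff less_numeral_extra(1) order_less_asym' uminus_complex.sel(2)
        imaginary_unit.sel(2) neg_less_0_iff_less)
  have v1: "norm v < 1"
    using norm_diff_less_norm_diff_cnj[of w \<i>] w wi by (simp add: v_def norm_divide divide_less_eq)
  have "1 + v = 2 * w / (w + \<i>)" "1 - v = 2 * \<i> / (w + \<i>)"
    using wi by (simp_all add: v_def field_simps)
  then have vw: "\<i> * (1 + v) / (1 - v) = w"
    using wi by simp
  have "norm (f (\<i> * (1 + v) / (1 - v)) - f (\<i> * (1 + 0) / (1 - 0)))
      \<le> norm v * norm (f (\<i> * (1 + v) / (1 - v)) - cnj (f (\<i> * (1 + 0) / (1 - 0))))"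
  proof (rule Schwarz_Pick_disc_half_plane)
    show "(\<lambda>v. f (\<i> * (1 + v) / (1 - v))) holomorphic_on ball 0 1"
      by (rule holomorphic_on_compose_gen[OF _ holf, unfolded o_def])
        (use Im_pos nz in \<open>auto intro!: holomorphic_intros\<close>)
  qed (use Im_pos pos v1 in auto)
  then have "norm (f w - f \<i>) \<le> norm v * norm (f w - cnj (f \<i>))"
    unfolding vw by simp
  then show ?thesis
    using wi by (simp add: v_def norm_divide field_simps)
qed

text \<open>The infinitesimal Schwarz--Pick inequality: divide the ball version by
  \<open>norm (w - z)\<close> and let \<open>w\<close> tend to \<open>z\<close>; the conjugate
  difference becomes \<open>2 * Im (f z)\<close>.\<close>

lemma norm_deriv_le_Im:
  assumes holf: "f holomorphic_on ball z d" and d: "d > 0"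
    and pos: "\<And>w. w \<in> ball z d \<Longrightarrow> Im (f w) > 0"
  shows "norm (deriv f z) \<le> 2 * Im (f z) / d"
proof -
  have df: "(f has_field_derivative deriv f z) (at z)"
    using holf d by (simp add: holomorphic_derivI)
  have "norm (deriv f z) \<le> norm (f z - cnj (f z)) / d"
  proof (rule tendsto_le)
    show "((\<lambda>w. norm ((f w - f z) / (w - z))) \<longlongrightarrow> norm (deriv f z)) (at z)"
      using df by (intro tendsto_norm) (simp add: has_field_derivative_iff)
    show "((\<lambda>w. norm (f w - cnj (f z)) / d) \<longlongrightarrow> norm (f z - cnj (f z)) / d) (at z)"
      using DERIV_isCont[OF df] d by (intro tendsto_intros) (auto simp: isCont_def)
    have "\<forall>\<^sub>F w in at z. w \<in> ball z d \<and> w \<noteq> z"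
      using d eventually_at_ball'[of d z UNIV] by (simp add: eventually_mono)
    then show "\<forall>\<^sub>F w in at z. norm ((f w - f z) / (w - z)) \<le> norm (f w - cnj (f z)) / d"
    proof eventually_elim
      case (elim w)
      with Schwarz_Pick_ball_half_plane[OF holf pos, of w] d show ?case
        by (simp add: norm_divide field_simps)
    qed
  qed simp
  also have "norm (f z - cnj (f z)) = 2 * Im (f z)"
    using pos[of z] d by (simp add: complex_diff_cnj norm_mult)
  finally show ?thesis .
qed

text \<open>Adding \<open>\<i> * m\<close> lifts the strip into the upper half-plane, with imaginary
  part below \<open>2 * m\<close>.\<close>

lemma norm_deriv_le_abs_Im:
  assumes holf: "f holomorphic_on ball z d" and d: "d > 0"
    and less: "\<And>w. w \<in> ball z d \<Longrightarrow> \<bar>Im (f w)\<bar> < m"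
  shows "norm (deriv f z) \<le> 4 * m / d"
proof -
  let ?g = "\<lambda>w. f w + \<i> * of_real m"
  have "norm (deriv ?g z) \<le> 2 * Im (?g z) / d"
  proof (rule norm_deriv_le_Im)
    show "?g holomorphic_on ball z d"
      by (intro holomorphic_intros holf)
    show "Im (?g w) > 0" if "w \<in> ball z d" for w
      using less[OF that] by simp
  qed (rule d)
  moreover have "deriv ?g z = deriv f z"
    using holf d by (intro DERIV_imp_deriv) (auto intro!: derivative_eq_intros holomorphic_derivI)
  moreover have "2 * Im (?g z) / d \<le> 4 * m / d"
    using less[of z] d by (intro divide_right_mono) auto
  ultimately show ?thesis
    by simp
qed

text \<open>With \<open>s\<close>, \<open>t\<close> the distances from \<open>w\<close> to
  \<open>-\<i>\<close> and \<open>\<i>\<close>, Schwarz--Pick gives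
  \<open>norm (f w) * (s - t) \<le> norm (f \<i>) * (s + t)\<close>. Since
  \<open>s\<^sup>2 - t\<^sup>2 = 4 * Im w\<close>, multiplying by \<open>s + t\<close> isolates
  \<open>Im w\<close>. The real part of \<open>f\<close> is bounded too.\<close>

lemma Im_growth_half_plane:
  assumes holf: "f holomorphic_on {w. Im w > 0}"
    and pos: "\<And>w. Im w > 0 \<Longrightarrow> Im (f w) > 0" and w: "Im w > 0"
  shows "norm (f w) \<le> norm (f \<i>) * (norm w + 1)\<^sup>2 / Im w"
proof -
  have wi: "norm (w + \<i>) > 0"
  proof -
    have "Im (w + \<i>) > 0" using w by simp
    then have "w + \<i> \<noteq> 0" by force
    then show ?thesis by simp
  qed
  define s where "s = norm (w + \<i>)"
  define t where "t = norm (w - \<i>)"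
  have s: "s > 0" using wi by (simp add: s_def)
  have "norm (f w) - norm (f \<i>) \<le> norm (f w - f \<i>)"
    by (rule norm_triangle_ineq2)
  moreover have "norm (f w - cnj (f \<i>)) \<le> norm (f w) + norm (f \<i>)"
    using norm_triangle_ineq4[of "f w" "cnj (f \<i>)"] by simp
  ultimately have "(norm (f w) - norm (f \<i>)) * s \<le> t * (norm (f w) + norm (f \<i>))"
    using Schwarz_Pick_half_plane[OF holf pos w] s
    by (smt (verit, best) mult_left_mono mult_right_mono norm_ge_zero s_def t_def)
  then have 1: "norm (f w) * (s - t) \<le> norm (f \<i>) * (s + t)"
    by (simp add: algebra_simps)
  have st: "s\<^sup>2 - t\<^sup>2 = 4 * Im w"
    unfolding s_def t_def cmod_power2 by (simp add: power2_eq_square algebra_simps)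
  have "norm (f w) * (4 * Im w) = norm (f w) * (s - t) * (s + t)"
    unfolding st[symmetric] by (simp add: power2_eq_square algebra_simps)
  also have "\<dots> \<le> norm (f \<i>) * (s + t) * (s + t)"
    using 1 s by (intro mult_right_mono) (auto simp: t_def)
  also have "\<dots> = norm (f \<i>) * (s + t)\<^sup>2"
    by (simp add: power2_eq_square)
  also have "\<dots> \<le> norm (f \<i>) * (2 * (norm w + 1))\<^sup>2"
    using norm_triangle_ineq[of w \<i>] norm_triangle_ineq4[of w \<i>] s
    by (intro mult_left_mono power_mono) (auto simp: s_def t_def)
  finally show ?thesis
    using w by (simp add: field_simps power2_eq_square)
qed

section \<open>Maximum principle and linear decay at a real segment\<close>

text \<open>Only the real part \<open>k\<close> has boundary values, \<open>g\<close> may have none.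
  At an interior maximum of \<open>k\<close> the modulus of \<open>exp (g w)\<close> is maximal, so
  \<open>exp (g w)\<close> is constant, and then \<open>k\<close> is constant up to the
  frontier.\<close>

lemma maximum_principle_Re:
  fixes k :: "complex \<Rightarrow> real"
  assumes S: "open S" "connected S" "bounded S" and contk: "continuous_on (closure S) k"
    and holg: "g holomorphic_on S" and kg: "\<And>w. w \<in> S \<Longrightarrow> k w = Re (g w)"
    and fr: "\<And>w. w \<in> frontier S \<Longrightarrow> k w \<le> c" and w: "w \<in> S"
  shows "k w \<le> c"
proof -
  have "compact (closure S)"
    using S by (simp add: compact_closure)
  then obtain z where z: "z \<in> closure S" "\<And>y. y \<in> closure S \<Longrightarrow> k y \<le> k z"
    using continuous_attains_sup[OF _ _ contk] w closure_subset by blast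
  have "k z \<le> c"
  proof (cases "z \<in> S")
    case True
    have "(\<lambda>w. exp (g w)) constant_on S"
    proof (rule maximum_modulus_principle[OF _ S(1,2,1) subset_refl True])
      show "(\<lambda>w. exp (g w)) holomorphic_on S"
        by (intro holomorphic_intros holg)
      show "norm (exp (g y)) \<le> norm (exp (g z))" if "y \<in> S" for y
        using z(2)[of y] that True closure_subset kg by (auto simp: subset_iff)
    qed
    then obtain a where a: "\<And>y. y \<in> S \<Longrightarrow> exp (g y) = a"
      by (auto simp: constant_on_def)
    have const: "k y = k z" if "y \<in> S" for y
    proof -
      have "norm (exp (g y)) = norm (exp (g z))"
        using a[OF that] a[OF True] by simp
      then show ?thesis
        using kg that True by simp
    qed
    have "frontier S \<noteq> {}"
      using S w by (metis empty_iff frontier_eq_empty not_bounded_UNIV)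
    then obtain y where y: "y \<in> frontier S" by blast
    have "k y = k z"
      by (rule continuous_constant_on_closure[OF contk const]) (use y in \<open>auto simp: frontier_def\<close>)
    then show ?thesis
      using fr[OF y] by simp
  next
    case False
    then have "z \<in> frontier S"
      using z S by (simp add: frontier_def interior_open)
    then show ?thesis by (rule fr)
  qed
  then show ?thesis
    using z(2)[of w] w closure_subset by force
qed

text \<open>The barrier is \<open>M (2 Y / r + (X\<^sup>2 - Y\<^sup>2) / r\<^sup>2)\<close> with \<open>w = x + X + \<i> Y\<close>: it is
  harmonic, nonnegative on the diameter and at least \<open>M\<close> on the half circle.\<close>

lemma half_disc_Im_upper:
  fixes x r :: real and h :: "complex \<Rightarrow> real"
  assumes holf: "f holomorphic_on ball (of_real x) r \<inter> {w. Im w > 0}"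
    and conth: "continuous_on (cball (of_real x) r \<inter> {w. Im w \<ge> 0}) h"
    and hf: "\<And>w. w \<in> ball (of_real x) r \<Longrightarrow> Im w > 0 \<Longrightarrow> h w = Im (f w)"
    and h0: "\<And>w. w \<in> cball (of_real x) r \<Longrightarrow> Im w = 0 \<Longrightarrow> h w = 0"
    and hM: "\<And>w. w \<in> cball (of_real x) r \<Longrightarrow> Im w \<ge> 0 \<Longrightarrow> h w \<le> M"
    and y: "0 < y" "y < r" and M: "M \<ge> 0"
  shows "Im (f (Complex x y)) \<le> 2 * M * y / r"
proof -
  let ?S = "ball (of_real x) r \<inter> {w. Im w > 0}"
  define b where "b w = of_real M * (- 2 * \<i> * (w - of_real x) / of_real r + (w - of_real x)\<^sup>2 / of_real (r\<^sup>2))" for w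
  have Re_b: "Re (b w) = M * (2 * Im w / r + ((Re w - x)\<^sup>2 - (Im w)\<^sup>2) / r\<^sup>2)" for w
    by (simp add: b_def Re_divide_of_real power2_eq_square del: of_real_power of_real_mult)
  have r: "r > 0" using y by simp
  have cl: "closure ?S \<subseteq> cball (of_real x) r \<inter> {w. Im w \<ge> 0}"
    by (rule closure_minimal) (auto intro!: closed_Int closed_halfspace_Im_ge simp: less_imp_le)
  have "h (Complex x y) - Re (b (Complex x y)) \<le> 0"
  proof (rule maximum_principle_Re[where S = ?S and k = "\<lambda>w. h w - Re (b w)" and w = "Complex x y" and g = "\<lambda>w. - \<i> * f w - b w"])
    show "open ?S" by (intro open_Int open_ball open_halfspace_Im_gt)
    show "connected ?S"
      by (intro convex_connected convex_Int convex_ball convex_halfspace_Im_gt)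
    show "bounded ?S" by (simp add: bounded_Int)
    show "continuous_on (closure ?S) (\<lambda>w. h w - Re (b w))"
      unfolding b_def using r by (intro continuous_intros continuous_on_subset[OF conth cl]) auto
    show "(\<lambda>w. - \<i> * f w - b w) holomorphic_on ?S"
      unfolding b_def using r by (intro holomorphic_intros holf) auto
    show "h w - Re (b w) = Re (- \<i> * f w - b w)" if "w \<in> ?S" for w
      using that hf by simp
    show "Complex x y \<in> ?S"
      using y by (simp add: dist_norm complex_eq_iff norm_complex_def)
    show "h w - Re (b w) \<le> 0" if w: "w \<in> frontier ?S" for w
    proof -
      have wc: "w \<in> cball (of_real x) r" "Im w \<ge> 0" and nS: "w \<notin> ?S"
        using w cl frontier_disjoint_eq[of ?S] 
        by (auto simp: frontier_def interior_open open_Int open_halfspace_Im_gt)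
      show ?thesis
      proof (cases "Im w = 0")
        case True
        then have "h w = 0" "Re (b w) \<ge> 0"
          using h0 wc M unfolding Re_b by auto
        then show ?thesis by simp
      next
        case False
        then have "dist (of_real x) w = r"
          using nS wc by auto
        then have "(norm (w - of_real x))\<^sup>2 = r\<^sup>2"
          by (simp add: dist_norm norm_minus_commute)
        then have c: "(Re w - x)\<^sup>2 = r\<^sup>2 - (Im w)\<^sup>2"
          unfolding cmod_power2 by simp
        then have "(Im w)\<^sup>2 \<le> r\<^sup>2"
          by (smt (verit) zero_le_power2)
        then have le: "Im w \<le> r"
          using r by (simp add: abs_le_square_iff[symmetric])
        have "Im w * Im w \<le> Im w * r"
          using le wc by (intro mult_left_mono) auto
        then have "(Im w)\<^sup>2 / r\<^sup>2 \<le> Im w / r"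
          using r by (simp add: power2_eq_square field_simps)
        then have "1 \<le> 1 + 2 * (Im w / r - (Im w)\<^sup>2 / r\<^sup>2)"
          by simp
        also have "\<dots> = 2 * Im w / r + ((Re w - x)\<^sup>2 - (Im w)\<^sup>2) / r\<^sup>2"
          unfolding c using r by (simp add: field_simps)
        finally have "1 \<le> 2 * Im w / r + ((Re w - x)\<^sup>2 - (Im w)\<^sup>2) / r\<^sup>2" .
        then have "M * 1 \<le> Re (b w)"
          unfolding Re_b using M by (intro mult_left_mono) auto
        then show ?thesis
          using hM wc by fastforce
      qed
    qed
  qed
  moreover have "Complex x y \<in> ball (of_real x) r"
    using y by (simp add: dist_norm complex_eq_iff norm_complex_def)
  ultimately have "Im (f (Complex x y)) \<le> M * (2 * y / r + (0 - y\<^sup>2) / r\<^sup>2)"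
    using hf[of "Complex x y"] y unfolding Re_b by simp
  also have "\<dots> \<le> M * (2 * y / r)"
    using M by (intro mult_left_mono) auto
  finally show ?thesis by (simp add: mult_ac)
qed

lemma half_disc_abs_Im_le:
  fixes x r :: real and h :: "complex \<Rightarrow> real"
  assumes holf: "f holomorphic_on ball (of_real x) r \<inter> {w. Im w > 0}"
    and conth: "continuous_on (cball (of_real x) r \<inter> {w. Im w \<ge> 0}) h"
    and hf: "\<And>w. w \<in> ball (of_real x) r \<Longrightarrow> Im w > 0 \<Longrightarrow> h w = Im (f w)"
    and h0: "\<And>w. w \<in> cball (of_real x) r \<Longrightarrow> Im w = 0 \<Longrightarrow> h w = 0"
    and hM: "\<And>w. w \<in> cball (of_real x) r \<Longrightarrow> Im w \<ge> 0 \<Longrightarrow> \<bar>h w\<bar> \<le> M"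
    and y: "0 < y" "y < r"
  shows "\<bar>Im (f (Complex x y))\<bar> \<le> 2 * M * y / r"
proof -
  have M: "M \<ge> 0"
    using hM[of "of_real x"] y by (simp add: abs_le_iff)
  have "Im (f (Complex x y)) \<le> 2 * M * y / r"
    by (rule half_disc_Im_upper[OF holf conth hf h0 _ y M]) (use hM in \<open>auto simp: abs_le_iff\<close>)
  moreover have "Im (- f (Complex x y)) \<le> 2 * M * y / r"
    by (rule half_disc_Im_upper[where f = "\<lambda>w. - f w" and h = "\<lambda>w. - h w", OF _ _ _ _ _ y M])
      (use holf conth hf h0 hM in \<open>auto simp: abs_le_iff intro!: holomorphic_intros continuous_intros\<close>)
  ultimately show ?thesis
    by (simp add: abs_le_iff)
qed

section \<open>Reflection from boundary values of the imaginary part\<close>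

text \<open>The \<open>\<delta>\<close> that the limit at \<open>x\<close> provides also serves for
  the limits at nearby points \<open>y\<close>, because non-strict distance bounds survive passage
  to the limit. This glues pointwise boundary limits into a continuous function.\<close>

lemma continuous_on_limit_extension:
  fixes f g :: "'a::metric_space \<Rightarrow> 'b::metric_space"
  assumes lim: "\<And>x. x \<in> T \<Longrightarrow> (f \<longlongrightarrow> g x) (at x within X)"
    and T: "T \<subseteq> closure X" and eq: "\<And>x. x \<in> X \<Longrightarrow> x \<in> T \<Longrightarrow> g x = f x"
  shows "continuous_on T g"
  unfolding continuous_on_iff
proof (intro ballI allI impI)
  fix x and e :: real
  assume x: "x \<in> T" and e: "0 < e"
  obtain \<delta> where \<delta>: "\<delta> > 0" "\<And>y. y \<in> X \<Longrightarrow> y \<noteq> x \<Longrightarrow> dist y x < \<delta> \<Longrightarrow> dist (f y) (g x) < e / 2"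
    using tendstoD[OF lim[OF x], of "e / 2"] e by (auto simp: eventually_at)
  show "\<exists>d>0. \<forall>y\<in>T. dist y x < d \<longrightarrow> dist (g y) (g x) < e"
  proof (intro exI conjI ballI impI, rule \<delta>)
    fix y assume y: "y \<in> T" "dist y x < \<delta>"
    consider "y = x" | "y \<noteq> x" "y \<in> X" | "y \<noteq> x" "y \<notin> X" by blast
    then show "dist (g y) (g x) < e"
    proof cases
      case 1
      then show ?thesis using e by simp
    next
      case 2
      then show ?thesis using \<delta>(2)[of y] y eq e by simp
    next
      case 3
      \<comment> \<open>The value at \<open>y\<close> is approached by \<open>z\<close> in
        \<open>X\<close>. The radius chosen below keeps \<open>z\<close> within
        \<open>\<delta>\<close> of \<open>x\<close>, and at the same time away from
        \<open>x\<close>, where the limit says nothing.\<close>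
      then have "y islimpt X"
        using y T by (auto simp: closure_def)
      then have nb: "at y within X \<noteq> bot"
        by (simp add: trivial_limit_within)
      have "\<forall>\<^sub>F z in at y within X. z \<in> ball y (min (\<delta> - dist y x) (dist y x))"
        using y 3 eventually_at_ball[of "min (\<delta> - dist y x) (dist y x)" y X]
        by (auto elim: eventually_mono)
      moreover have "\<forall>\<^sub>F z in at y within X. z \<in> X"
        by (simp add: eventually_at_topological) blast
      ultimately have ev: "\<forall>\<^sub>F z in at y within X. dist (f z) (g x) \<le> e / 2"
      proof eventually_elim
        case (elim z)
        then have "dist z x < \<delta>" "z \<noteq> x"
          using dist_triangle[of z x y] by (auto simp: dist_commute)
        then show ?case using \<delta>(2)[of z] elim by (simp add: less_imp_le)
      qed
      have "dist (g y) (g x) \<le> e / 2"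
        by (rule tendsto_upperbound[OF tendsto_dist[OF lim[OF y(1)] tendsto_const] ev nb])
      then show ?thesis using e by simp
    qed
  qed
qed

lemma closure_upper_half_plane: "closure {w. Im w > 0} = {w. Im w \<ge> 0}"
proof -
  have "inner \<i> w = Im w" for w
    by (simp add: inner_complex_def)
  then show ?thesis
    using closure_halfspace_gt[of \<i> 0] by simp
qed

lemma in_closure_upper_half_plane: "Im x = 0 \<Longrightarrow> x \<in> closure {w. Im w > 0}"
  by (simp add: closure_upper_half_plane)

text \<open>By the half-disc barrier \<open>Im f\<close> is at most a constant times
  \<open>Im w\<close>; on a ball of radius \<open>Im w / 2\<close> the derivative estimate then
  yields a bound independent of \<open>w\<close>. So \<open>f\<close> is Lipschitz on a convex
  rectangle touching \<open>x\<close>, and has a limit there.\<close>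

lemma boundary_limit_of_Im_tendsto_0:
  assumes S: "open S" and holf: "f holomorphic_on S \<inter> {w. Im w > 0}"
    and lim: "\<And>x. x \<in> S \<Longrightarrow> Im x = 0 \<Longrightarrow> ((\<lambda>w. Im (f w)) \<longlongrightarrow> 0) (at x within {w. Im w > 0})"
    and x: "x \<in> S" "Im x = 0"
  obtains l where "(f \<longlongrightarrow> l) (at x within {w. Im w > 0})"
proof -
  let ?H = "{w. Im w > 0}"
  have oSH: "open (S \<inter> ?H)"
    using S by (simp add: open_Int open_halfspace_Im_gt)
  define h where "h w = (if Im w > 0 then Im (f w) else 0)" for w
  have conth: "continuous_on (S \<inter> {w. Im w \<ge> 0}) h"
  proof (rule continuous_on_limit_extension[where f = "\<lambda>w. Im (f w)" and X = "S \<inter> ?H"])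
    fix y assume y: "y \<in> S \<inter> {w. Im w \<ge> 0}"
    show "((\<lambda>w. Im (f w)) \<longlongrightarrow> h y) (at y within S \<inter> ?H)"
    proof (cases "Im y > 0")
      case True
      then have "continuous_on (S \<inter> ?H) (\<lambda>w. Im (f w))"
        by (intro continuous_intros holomorphic_on_imp_continuous_on holf)
      then show ?thesis
        using True y by (auto simp: h_def continuous_on_def)
    next
      case False
      then show ?thesis
        using y lim[of y] tendsto_within_subset[of _ _ y ?H "S \<inter> ?H"] by (auto simp: h_def)
    qed
  next
    show "S \<inter> {w. Im w \<ge> 0} \<subseteq> closure (S \<inter> ?H)"
      using open_Int_closure_subset[OF S, of ?H] by (simp add: closure_upper_half_plane)
  qed (auto simp: h_def)
  obtain r' where r': "r' > 0" "cball x r' \<subseteq> S"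
    using S x open_contains_cball by blast
  \<comment> \<open>Halving leaves room: a half-disc of radius \<open>r\<close> about any real point
    within \<open>r\<close> of \<open>x\<close> stays in \<open>S\<close>, so a single bound
    \<open>M\<close> serves all of them.\<close>
  define r where "r = r' / 2"
  have r: "r > 0" and xS: "cball x (2 * r) \<subseteq> S"
    using r' by (auto simp: r_def)
  define a where "a = Re x"
  have xa: "x = of_real a"
    using x by (simp add: complex_eq_iff a_def)
  let ?K = "cball x (2 * r) \<inter> {w. Im w \<ge> 0}"
  have contK: "continuous_on ?K h"
    by (rule continuous_on_subset[OF conth]) (use xS in auto)
  have "compact ?K"
    by (intro compact_Int_closed compact_cball closed_halfspace_Im_ge)
  then have "bounded (h ` ?K)"
    by (intro compact_imp_bounded compact_continuous_image contK)
  then obtain M where M: "M > 0" "\<And>w. w \<in> ?K \<Longrightarrow> \<bar>h w\<bar> \<le> M"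
    by (auto simp: bounded_pos)
  have Im_le: "\<bar>Im (f w)\<bar> \<le> 2 * M * Im w / r"
    if w: "\<bar>Re w - a\<bar> < r" "0 < Im w" "Im w < r" for w
  proof -
    have sub: "cball (of_real (Re w)) r \<subseteq> cball x (2 * r)"
      using w by (simp add: cball_subset_cball_iff xa dist_norm flip: of_real_diff)
    have "\<bar>Im (f (Complex (Re w) (Im w)))\<bar> \<le> 2 * M * Im w / r"
    proof (rule half_disc_abs_Im_le[where h = h])
      show "f holomorphic_on ball (of_real (Re w)) r \<inter> ?H"
        by (rule holomorphic_on_subset[OF holf]) (use sub xS ball_subset_cball in blast)
      show "continuous_on (cball (of_real (Re w)) r \<inter> {w. Im w \<ge> 0}) h"
        by (rule continuous_on_subset[OF contK]) (use sub in auto)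
      show "\<bar>h v\<bar> \<le> M" if "v \<in> cball (of_real (Re w)) r" "Im v \<ge> 0" for v
        using M(2) sub that by blast
    qed (use w in \<open>auto simp: h_def\<close>)
    then show ?thesis by simp
  qed
  define R where "R = {w. \<bar>Re w - a\<bar> < r / 2 \<and> 0 < Im w \<and> Im w < r / 2}"
  have dist_x: "dist x w < 2 * r" if "\<bar>Re w - a\<bar> < r" "0 < Im w" "Im w < r" for w
    using cmod_le[of "w - x"] that by (simp add: dist_norm norm_minus_commute xa)
  have df: "(f has_field_derivative deriv f w) (at w)" and dle: "norm (deriv f w) \<le> 32 * M / r"
    if w: "w \<in> R" for w
  proof -
    have inS: "v \<in> S \<inter> ?H" if "\<bar>Re v - a\<bar> < r" "0 < Im v" "Im v < r" for v
      using dist_x[OF that] xS that by force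
    then have "w \<in> S \<inter> ?H"
      using w r by (auto simp: R_def)
    then show "(f has_field_derivative deriv f w) (at w)"
      by (intro holomorphic_derivI[OF holf oSH])
    have near: "\<bar>Re v - a\<bar> < r \<and> 0 < Im v \<and> Im v < r \<and> Im v < 3 / 2 * Im w"
      if "v \<in> ball w (Im w / 2)" for v
    proof -
      have "\<bar>Re (v - w)\<bar> < Im w / 2" "\<bar>Im (v - w)\<bar> < Im w / 2"
        using that abs_Re_le_cmod[of "v - w"] abs_Im_le_cmod[of "v - w"]
        by (auto simp: dist_norm norm_minus_commute)
      then show ?thesis
        using w unfolding R_def mem_Collect_eq minus_complex.sel by (intro conjI; linarith)
    qed
    \<comment> \<open>On this ball \<open>Im v < 3/2 * Im w\<close>, so \<open>|Im (f v)|\<close> is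
      below \<open>3 * M * Im w / r\<close>; rounding 3 up to 4 leaves the bound strict.\<close>
    have "norm (deriv f w) \<le> 4 * (4 * M * Im w / r) / (Im w / 2)"
    proof (rule norm_deriv_le_abs_Im)
      show "f holomorphic_on ball w (Im w / 2)"
        by (rule holomorphic_on_subset[OF holf]) (use near inS in blast)
      show "Im w / 2 > 0" using w by (simp add: R_def)
      show "\<bar>Im (f v)\<bar> < 4 * M * Im w / r" if "v \<in> ball w (Im w / 2)" for v
      proof -
        have "\<bar>Im (f v)\<bar> \<le> 2 * M * Im v / r"
          using near[OF that] by (intro Im_le) auto
        also have "\<dots> < 4 * M * Im w / r"
          using near[OF that] w M r by (auto simp: R_def divide_strict_right_mono)
        finally show ?thesis .
      qed
    qed
    also have "\<dots> = 32 * M / r"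
      using w by (simp add: R_def field_simps)
    finally show "norm (deriv f w) \<le> 32 * M / r" .
  qed
  have R_eq: "R = box (Complex (a - r / 2) 0) (Complex (a + r / 2) (r / 2))"
    unfolding R_def abs_less_iff by (auto simp: in_box_complex_iff)
  have "convex R"
    unfolding R_eq by (rule convex_box)
  have "(32 * M / r)-lipschitz_on R f"
  proof (rule lipschitz_onI)
    show "dist (f v) (f w) \<le> 32 * M / r * dist v w" if "v \<in> R" "w \<in> R" for v w
      unfolding dist_norm
      by (rule field_differentiable_bound[OF \<open>convex R\<close> DERIV_subset[OF df] dle]) (use that in auto)
  qed (use M r in auto)
  then have uc: "uniformly_continuous_on R f"
    by (rule lipschitz_on_uniformly_continuous)
  let ?B = "{w. \<bar>Re w - a\<bar> < r / 2 \<and> Im w < r / 2}"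
  have oB: "open ?B"
    by (intro open_Collect_conj open_Collect_less continuous_intros)
  have R_Int: "R = ?B \<inter> ?H"
    by (auto simp: R_def)
  have xB: "x \<in> ?B"
    using r xa by auto
  have "x \<in> closure R"
    using open_Int_closure_subset[OF oB, of ?H] xB x unfolding R_Int
    by (auto simp: in_closure_upper_half_plane)
  then obtain l where l: "(f \<longlongrightarrow> l) (at x within R)"
    using uniformly_continuous_on_extension_at_closure[OF uc] by blast
  moreover have "at x within R = at x within ?H"
    by (rule at_within_nhd[OF xB oB]) (auto simp: R_Int)
  ultimately show ?thesis
    using that by simp
qed

text \<open>The preceding lemma supplies limits of \<open>f\<close> itself at the real points, and
  these are real. With them as boundary values the Schwarz reflection principle applies.\<close>

lemma real_boundary_extension:
  assumes S: "open S" and cnjS: "cnj ` S \<subseteq> S" and holf: "f holomorphic_on S \<inter> {w. Im w > 0}"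
    and lim: "\<And>x. x \<in> S \<Longrightarrow> Im x = 0 \<Longrightarrow> ((\<lambda>w. Im (f w)) \<longlongrightarrow> 0) (at x within {w. Im w > 0})"
  obtains g where "g holomorphic_on S" "\<And>w. w \<in> S \<Longrightarrow> Im w > 0 \<Longrightarrow> g w = f w"
    "\<And>w. w \<in> S \<Longrightarrow> g (cnj w) = cnj (g w)"
proof -
  let ?H = "{w. Im w > 0}"
  have "\<exists>l. (f \<longlongrightarrow> l) (at x within ?H)" if "x \<in> S" "Im x = 0" for x
    using boundary_limit_of_Im_tendsto_0[OF S holf lim that] by blast
  then obtain L where L: "\<And>x. x \<in> S \<Longrightarrow> Im x = 0 \<Longrightarrow> (f \<longlongrightarrow> L x) (at x within ?H)"
    by metis
  have nb: "at x within ?H \<noteq> bot" if "Im x = 0" for x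
    using in_closure_upper_half_plane[OF that] that
    by (auto simp: trivial_limit_within closure_def)
  have Im_L: "Im (L x) = 0" if "x \<in> S" "Im x = 0" for x
    using tendsto_unique[OF nb[OF that(2)] tendsto_Im[OF L[OF that]] lim[OF that]] .
  define F where "F w = (if Im w > 0 then f w else L w)" for w
  have contF: "continuous_on (S \<inter> {w. Im w \<ge> 0}) F"
  proof (rule continuous_on_limit_extension[where f = f and X = "S \<inter> ?H"])
    fix y assume y: "y \<in> S \<inter> {w. Im w \<ge> 0}"
    show "(f \<longlongrightarrow> F y) (at y within S \<inter> ?H)"
    proof (cases "Im y > 0")
      case True
      then show ?thesis
        using y holomorphic_on_imp_continuous_on[OF holf] by (auto simp: F_def continuous_on_def)
    next
      case False
      then show ?thesis
        using y L[of y] tendsto_within_subset[of _ _ y ?H "S \<inter> ?H"] by (auto simp: F_def)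
    qed
  next
    show "S \<inter> {w. Im w \<ge> 0} \<subseteq> closure (S \<inter> ?H)"
      using open_Int_closure_subset[OF S, of ?H] by (simp add: closure_upper_half_plane)
  qed (auto simp: F_def)
  have holF: "F holomorphic_on S \<inter> ?H"
    by (rule holomorphic_transform[OF holf]) (auto simp: F_def)
  have FR: "F z \<in> \<real>" if "z \<in> S" "z \<in> \<real>" for z
    using that Im_L[of z] by (simp add: F_def complex_is_Real_iff)
  define g where "g z = (if 0 \<le> Im z then F z else cnj (F (cnj z)))" for z
  show ?thesis
  proof
    show "g holomorphic_on S"
      unfolding g_def by (rule Schwarz_reflection[OF S cnjS holF contF FR])
    show "g w = f w" if "w \<in> S" "Im w > 0" for w
      using that by (simp add: g_def F_def)
    show "g (cnj w) = cnj (g w)" if "w \<in> S" for w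
    proof (cases "Im w = 0")
      case True
      then have "cnj w = w" "cnj (F w) = F w"
        using FR[OF that] by (auto simp: complex_is_Real_iff complex_eq_iff)
      then show ?thesis using True by (simp add: g_def)
    qed (auto simp: g_def)
  qed
qed

section \<open>Rigidity for imaginary parts bounded below\<close>

text \<open>Harnack bounds the entire function \<open>g\<close> obtained by reflection by \<open>C R\<^sup>2 / \<bar>Im w\<bar>\<close> on
  \<open>\<bar>w\<bar> = R\<close>; the factor \<open>1 - w\<^sup>2 / R\<^sup>2\<close>, of modulus \<open>2 \<bar>Im w\<bar> / R\<close> on that circle, removes
  the singularity at the real axis and leaves linear growth.\<close>

lemma half_plane_rigidity:
  assumes holf: "f holomorphic_on {w. Im w > 0}"
    and ge: "\<And>w. Im w > 0 \<Longrightarrow> Im (f w) \<ge> - K"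
    and lim: "\<And>x. Im x = 0 \<Longrightarrow> ((\<lambda>w. Im (f w)) \<longlongrightarrow> 0) (at x within {w. Im w > 0})"
  obtains c d :: real where "c \<ge> 0" "\<And>w. Im w > 0 \<Longrightarrow> f w = of_real c * w + of_real d"
proof -
  let ?H = "{w. Im w > 0}"
  obtain g where holg: "g holomorphic_on UNIV" and gf: "\<And>w. Im w > 0 \<Longrightarrow> g w = f w"
    and gcnj: "\<And>w. g (cnj w) = cnj (g w)"
    using real_boundary_extension[of UNIV f] holf lim by auto
  \<comment> \<open>Shifting \<open>f\<close> by \<open>\<i> * m\<close> makes the imaginary part
    strictly positive, as the growth estimate demands.\<close>
  define m where "m = \<bar>K\<bar> + 1"
  define k where "k w = f w + \<i> * of_real m" for w
  define C where "C = 4 * norm (k \<i>) + m"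
  have m: "m > 0" by (simp add: m_def)
  then have C: "C > 0" by (simp add: C_def add_nonneg_pos)
  have upper: "norm (g w) * Im w \<le> C * R\<^sup>2" if "norm w = R" "R \<ge> 1" "Im w > 0" for w R
  proof -
    have "norm (k w) \<le> norm (k \<i>) * (norm w + 1)\<^sup>2 / Im w"
    proof (rule Im_growth_half_plane)
      show "k holomorphic_on ?H"
        unfolding k_def by (intro holomorphic_intros holf)
      show "Im (k v) > 0" if "Im v > 0" for v
        using ge[OF that] by (simp add: k_def m_def)
    qed (rule that)
    then have "norm (k w) * Im w \<le> norm (k \<i>) * (norm w + 1)\<^sup>2"
      using that by (simp add: field_simps)
    also have "\<dots> \<le> norm (k \<i>) * (2 * R)\<^sup>2"
      using that by (intro mult_left_mono power_mono) auto
    finally have 1: "norm (k w) * Im w \<le> norm (k \<i>) * 4 * R\<^sup>2"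
      by (simp add: power2_eq_square)
    have "Im w \<le> R"
      using abs_Im_le_cmod[of w] that by simp
    also have "\<dots> \<le> R\<^sup>2"
      using that by (simp add: power2_eq_square)
    finally have 2: "m * Im w \<le> m * R\<^sup>2"
      using m by simp
    have "g w = k w - \<i> * of_real m"
      using gf that by (simp add: k_def)
    then have "norm (g w) \<le> norm (k w) + m"
      using norm_triangle_ineq4[of "k w" "\<i> * of_real m"] m by (simp add: norm_mult)
    then have "norm (g w) * Im w \<le> (norm (k w) + m) * Im w"
      using that by (intro mult_right_mono) auto
    then show ?thesis
      using 1 2 by (simp add: C_def algebra_simps)
  qed
  have both: "norm (g w) * \<bar>Im w\<bar> \<le> C * R\<^sup>2" if "norm w = R" "R \<ge> 1" for w R
  proof -
    consider "Im w > 0" | "Im w = 0" | "Im w < 0" by linarith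
    then show ?thesis
    proof cases
      case 3
      have "norm (g (cnj w)) * Im (cnj w) \<le> C * R\<^sup>2"
        using that 3 by (intro upper) auto
      then show ?thesis using 3 gcnj[of w] by simp
    qed (use upper[of w R] that C in auto)
  qed
  have circle: "norm (1 - w\<^sup>2 / of_real (R\<^sup>2)) = 2 * \<bar>Im w\<bar> / R" if "norm w = R" "R \<ge> 1" for w R
  proof -
    \<comment> \<open>On the circle \<open>R\<^sup>2 = w * cnj w\<close>, so the factor is
      \<open>(cnj w - w) / cnj w\<close>.\<close>
    have ww: "of_real (R\<^sup>2) = w * cnj w"
      using that complex_norm_square[of w] by simp
    have w0: "w \<noteq> 0" using that by auto
    have "1 - w\<^sup>2 / of_real (R\<^sup>2) = (cnj w - w) / cnj w"
      unfolding ww using w0 by (simp add: power2_eq_square field_simps)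
    moreover have "cnj w - w = - (2 * \<i> * of_real (Im w))"
      by (simp add: complex_eq_iff)
    then have "norm (cnj w - w) = 2 * \<bar>Im w\<bar>"
      by (simp add: norm_mult)
    ultimately show ?thesis
      using that by (simp add: norm_divide)
  qed
  have linear_growth: "norm (g w) \<le> 6 * C * norm w ^ 1" if w: "1 \<le> norm w" for w
  proof -
    \<comment> \<open>At half the radius the factor \<open>1 - w\<^sup>2 / R\<^sup>2\<close> has
      modulus at least 3/4. Dividing \<open>2 * C * R = 4 * C * norm w\<close> by 3/4 gives 16/3,
      rounded up to 6.\<close>
    define R where "R = 2 * norm w"
    have R: "R \<ge> 1" "norm w < R" using w by (auto simp: R_def)
    define Q where "Q v = g v * (1 - v\<^sup>2 / of_real (R\<^sup>2))" for v
    have "norm (Q w) \<le> 2 * C * R"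
    proof (rule maximum_modulus_frontier[where f = Q and S = "ball 0 R" and \<xi> = w])
      show "Q holomorphic_on interior (ball 0 R)"
        unfolding Q_def using R by (intro holomorphic_intros holomorphic_on_subset[OF holg]) auto
      show "continuous_on (closure (ball 0 R)) Q"
        unfolding Q_def using R
        by (intro continuous_intros continuous_on_subset[OF holomorphic_on_imp_continuous_on[OF holg]]) auto
      show "bounded (ball (0::complex) R)" by simp
      show "w \<in> ball 0 R" using R by simp
      show "norm (Q v) \<le> 2 * C * R" if "v \<in> frontier (ball 0 R)" for v
      proof -
        have v: "norm v = R" using that R by simp
        have "norm (Q v) = (norm (g v) * \<bar>Im v\<bar>) * 2 / R"
          unfolding Q_def norm_mult circle[OF v R(1)] by simp
        also have "\<dots> \<le> (C * R\<^sup>2) * 2 / R"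
          using both[OF v R(1)] R by (intro divide_right_mono mult_right_mono) auto
        finally show ?thesis using R by (simp add: power2_eq_square)
      qed
    qed
    moreover have "3 / 4 \<le> norm (1 - w\<^sup>2 / of_real (R\<^sup>2))"
    proof -
      have "w \<noteq> 0" using w by auto
      then have "norm (w\<^sup>2 / of_real (R\<^sup>2)) = 1 / 4"
        by (simp add: R_def norm_divide norm_power norm_mult power_mult_distrib)
      then show ?thesis
        using norm_triangle_ineq2[of 1 "w\<^sup>2 / of_real (R\<^sup>2)"] by simp
    qed
    then have "norm (g w) * (3 / 4) \<le> norm (Q w)"
      unfolding Q_def norm_mult by (intro mult_left_mono) auto
    moreover have "0 \<le> C * norm w" using C by simp
    ultimately show ?thesis
      by (simp add: R_def)
  qed
  have lin: "g w = g 0 + deriv g 0 * w" for w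
  proof -
    have "g w = (\<Sum>k\<le>1. (deriv ^^ k) g 0 / fact k * w ^ k)"
      by (rule Liouville_polynomial[OF holg linear_growth])
    also have "\<dots> = g 0 + deriv g 0 * w"
      by simp
    finally show ?thesis .
  qed
  have Im0: "Im (g x) = 0" if "Im x = 0" for x
  proof -
    have "cnj x = x" using that by (simp add: complex_eq_iff)
    then have "g x = cnj (g x)" using gcnj[of x] by simp
    then show ?thesis by (simp add: complex_eq_iff)
  qed
  have d: "g 0 = of_real (Re (g 0))"
    using Im0[of 0] by (simp add: complex_eq_iff)
  have "Im (deriv g 0) = 0"
    using Im0[of 1] Im0[of 0] arg_cong[OF lin[of 1], of Im] by simp
  then have c: "deriv g 0 = of_real (Re (deriv g 0))"
    by (simp add: complex_eq_iff)
  define cc where "cc = Re (deriv g 0)"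
  have eq: "f w = of_real cc * w + of_real (Re (g 0))" if "Im w > 0" for w
    unfolding cc_def c[symmetric] d[symmetric] gf[OF that, symmetric] using lin[of w] by (simp add: add.commute)
  have "cc \<ge> 0"
  proof (rule ccontr)
    assume neg: "\<not> cc \<ge> 0"
    \<comment> \<open>At \<open>\<i> * y\<close> the imaginary part would equal \<open>- m\<close>,
      which is less than \<open>- K\<close>.\<close>
    define y where "y = m / - cc"
    have y: "y > 0" using neg m unfolding y_def by (intro divide_pos_pos) auto
    have "Im (f (\<i> * of_real y)) = cc * y"
      using eq[of "\<i> * of_real y"] y by simp
    also have "\<dots> = - m" using neg by (simp add: y_def)
    finally show False
      using ge[of "\<i> * of_real y"] y by (simp add: m_def)
  qed
  then show ?thesis
    using eq by (rule that)
qed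

section \<open>Harmonic functions as imaginary parts\<close>

text \<open>The second difference over a parallelogram is \<open>t\<^sup>2\<close> times the mixed
  derivative, up to \<open>o(t\<^sup>2)\<close>. Differentiability of \<open>Du z v\<close> at the
  single point \<open>a\<close> suffices: the mean value theorem is used along \<open>v\<close>
  only, and both resulting points are compared with the linearization \<open>A\<close>.\<close>

lemma double_difference_estimate:
  fixes u :: "'a::real_normed_vector \<Rightarrow> real"
  assumes U: "open U" "a \<in> U" and diff: "\<And>z. z \<in> U \<Longrightarrow> (u has_derivative Du z) (at z)"
    and A: "((\<lambda>z. Du z v) has_derivative A) (at a)" and e: "e > 0"
  shows "\<forall>\<^sub>F t in at_right (0::real).
    \<bar>u (a + t *\<^sub>R v + t *\<^sub>R w) - u (a + t *\<^sub>R v) - u (a + t *\<^sub>R w) + u a - t\<^sup>2 * A w\<bar> \<le> e * t\<^sup>2"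
proof -
  interpret A: bounded_linear A
    using A by (rule has_derivative_bounded_linear)
  \<comment> \<open>Each of the two linearization errors is \<open>e / c\<close> times at most
    \<open>t * (norm v + norm w)\<close>; this \<open>c\<close> makes their sum at most
    \<open>e * t\<close>. The summand 1 keeps \<open>c\<close> positive for
    \<open>v = w = 0\<close>.\<close>
  define c where "c = 2 * (norm v + norm w) + 1"
  have c: "c > 0" by (simp add: c_def add_nonneg_pos)
  obtain r where r: "r > 0" "ball a r \<subseteq> U"
    using U open_contains_ball by blast
  obtain s where s: "s > 0" "\<And>z. norm (z - a) < s \<Longrightarrow>
      \<bar>Du z v - Du a v - A (z - a)\<bar> \<le> e / c * norm (z - a)"
    using has_derivative_at_alt[THEN iffD1, OF A, THEN conjunct2, rule_format, of "e / c"] e c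
    by auto
  define t0 where "t0 = min r s / c"
  have t0: "t0 > 0" using r s c by (simp add: t0_def)
  have main: "\<bar>u (a + t *\<^sub>R v + t *\<^sub>R w) - u (a + t *\<^sub>R v) - u (a + t *\<^sub>R w) + u a - t\<^sup>2 * A w\<bar>
      \<le> e * t\<^sup>2" if t: "0 < t" "t < t0" for t
  proof -
    have near: "norm (x *\<^sub>R v + y *\<^sub>R w) \<le> t * (norm v + norm w)"
      if "0 \<le> x" "x \<le> t" "0 \<le> y" "y \<le> t" for x y
    proof -
      have "norm (x *\<^sub>R v + y *\<^sub>R w) \<le> x * norm v + y * norm w"
        using norm_triangle_ineq[of "x *\<^sub>R v" "y *\<^sub>R w"] that by simp
      also have "\<dots> \<le> t * norm v + t * norm w"
        using that by (intro add_mono mult_right_mono) auto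
      finally show ?thesis by (simp add: distrib_left)
    qed
    have tc: "t * (norm v + norm w) < min r s"
    proof -
      have "t * (norm v + norm w) \<le> t * c"
        using t by (intro mult_left_mono) (auto simp: c_def)
      also have "\<dots> < t0 * c"
        using t c by simp
      finally show ?thesis using c by (simp add: t0_def)
    qed
    have inU: "a + x *\<^sub>R v + y *\<^sub>R w \<in> U" and ins: "norm (x *\<^sub>R v + y *\<^sub>R w) < s"
      if "0 \<le> x" "x \<le> t" "0 \<le> y" "y \<le> t" for x y
    proof -
      show "norm (x *\<^sub>R v + y *\<^sub>R w) < s"
        using near[OF that] tc by simp
      have "dist a (a + x *\<^sub>R v + y *\<^sub>R w) = norm (x *\<^sub>R v + y *\<^sub>R w)"
        by (simp add: dist_norm norm_minus_commute algebra_simps)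
      also have "\<dots> < r"
        using near[OF that] tc by simp
      finally show "a + x *\<^sub>R v + y *\<^sub>R w \<in> U"
        using r by auto
    qed
    define \<phi> where "\<phi> x = u (a + x *\<^sub>R v + t *\<^sub>R w) - u (a + x *\<^sub>R v)" for x
    define \<phi>' where "\<phi>' x = Du (a + x *\<^sub>R v + t *\<^sub>R w) v - Du (a + x *\<^sub>R v) v" for x
    have d\<phi>: "(\<phi> has_real_derivative \<phi>' x) (at x)" if "0 \<le> x" "x \<le> t" for x
    proof -
      have aff: "((\<lambda>x. a + x *\<^sub>R v + b) has_derivative (\<lambda>h. h *\<^sub>R v)) (at x)" for b
        by (auto intro!: derivative_eq_intros)
      have *: "((\<lambda>x. u (a + x *\<^sub>R v + y *\<^sub>R w)) has_real_derivative Du (a + x *\<^sub>R v + y *\<^sub>R w) v) (at x)"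
        if "0 \<le> y" "y \<le> t" for y
      proof -
        have D: "(u has_derivative Du (a + x *\<^sub>R v + y *\<^sub>R w)) (at (a + x *\<^sub>R v + y *\<^sub>R w))"
          using inU[OF \<open>0 \<le> x\<close> \<open>x \<le> t\<close> that] by (rule diff)
        interpret D: bounded_linear "Du (a + x *\<^sub>R v + y *\<^sub>R w)"
          using D by (rule has_derivative_bounded_linear)
        have "((\<lambda>x. u (a + x *\<^sub>R v + y *\<^sub>R w)) has_derivative
            (\<lambda>h. Du (a + x *\<^sub>R v + y *\<^sub>R w) (h *\<^sub>R v))) (at x)"
          by (rule has_derivative_compose[OF aff D])
        then show ?thesis
          by (simp add: has_field_derivative_def D.scaleR mult_commute_abs)
      qed
      show ?thesis
        unfolding \<phi>_def \<phi>'_def using *[of t] *[of 0] t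
        by (auto intro!: DERIV_diff)
    qed
    obtain x where x: "0 < x" "x < t" "\<phi> t - \<phi> 0 = (t - 0) * \<phi>' x"
      using MVT2[OF t(1) d\<phi>] by auto
    let ?y = "x *\<^sub>R v + t *\<^sub>R w" and ?z = "x *\<^sub>R v + 0 *\<^sub>R w"
    have est: "\<bar>Du (a + h) v - Du a v - A h\<bar> \<le> e / c * (t * (norm v + norm w))"
      if "norm h < s" "norm h \<le> t * (norm v + norm w)" for h
    proof -
      have "\<bar>Du (a + h) v - Du a v - A h\<bar> \<le> e / c * norm h"
        using s(2)[of "a + h"] that by simp
      also have "\<dots> \<le> e / c * (t * (norm v + norm w))"
        using that e c by (intro mult_left_mono) auto
      finally show ?thesis .
    qed
    have "\<bar>Du (a + ?y) v - Du a v - A ?y\<bar> \<le> e / c * (t * (norm v + norm w))"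
      by (intro est ins near) (use x in auto)
    moreover have "\<bar>Du (a + ?z) v - Du a v - A ?z\<bar> \<le> e / c * (t * (norm v + norm w))"
      by (intro est ins near) (use x in auto)
    moreover have "\<phi>' x - t * A w = (Du (a + ?y) v - Du a v - A ?y) - (Du (a + ?z) v - Du a v - A ?z)"
      by (simp add: \<phi>'_def A.add A.scaleR add.assoc)
    ultimately have "\<bar>\<phi>' x - t * A w\<bar> \<le> 2 * (e / c * (t * (norm v + norm w)))"
      by linarith
    also have "\<dots> = e * t * (2 * (norm v + norm w) / c)"
      by simp
    also have "\<dots> \<le> e * t * 1"
      using e t c by (intro mult_left_mono) (auto simp: c_def)
    finally have "\<bar>\<phi>' x - t * A w\<bar> \<le> e * t" by simp
    then have "t * \<bar>\<phi>' x - t * A w\<bar> \<le> t * (e * t)"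
      using t by (intro mult_left_mono) auto
    moreover have "u (a + t *\<^sub>R v + t *\<^sub>R w) - u (a + t *\<^sub>R v) - u (a + t *\<^sub>R w) + u a - t\<^sup>2 * A w
        = t * (\<phi>' x - t * A w)"
      using x by (simp add: \<phi>_def power2_eq_square algebra_simps)
    ultimately show ?thesis
      using t by (simp add: abs_mult power2_eq_square mult_ac)
  qed
  show ?thesis
    unfolding eventually_at_right_field using t0 main by blast
qed

text \<open>The second difference does not change when \<open>v\<close> and \<open>w\<close> are
  swapped, yet it is approximated by \<open>t\<^sup>2 * A w\<close> and by
  \<open>t\<^sup>2 * B v\<close>.\<close>

lemma symmetric_second_derivative:
  fixes u :: "'a::real_normed_vector \<Rightarrow> real"
  assumes U: "open U" "a \<in> U" and diff: "\<And>z. z \<in> U \<Longrightarrow> (u has_derivative Du z) (at z)"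
    and A: "((\<lambda>z. Du z v) has_derivative A) (at a)"
    and B: "((\<lambda>z. Du z w) has_derivative B) (at a)"
  shows "A w = B v"
proof -
  have "\<bar>A w - B v\<bar> \<le> 0 + e" if "e > 0" for e
  proof -
    have e2: "e / 2 > 0" using that by simp
    have ev: "\<forall>\<^sub>F t in at_right 0.
        \<bar>u (a + t *\<^sub>R v + t *\<^sub>R w) - u (a + t *\<^sub>R v) - u (a + t *\<^sub>R w) + u a - t\<^sup>2 * A w\<bar> \<le> e / 2 * t\<^sup>2"
      "\<forall>\<^sub>F t in at_right 0.
        \<bar>u (a + t *\<^sub>R w + t *\<^sub>R v) - u (a + t *\<^sub>R w) - u (a + t *\<^sub>R v) + u a - t\<^sup>2 * B v\<bar> \<le> e / 2 * t\<^sup>2"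
      using double_difference_estimate[OF U diff A e2] double_difference_estimate[OF U diff B e2]
      by blast+
    have "\<forall>\<^sub>F t in at_right (0::real). t > 0 \<and> \<bar>t\<^sup>2 * (A w - B v)\<bar> \<le> e * t\<^sup>2"
      using ev(1,2) eventually_at_right_less[of 0]
    proof eventually_elim
      case (elim t)
      have "a + t *\<^sub>R w + t *\<^sub>R v = a + t *\<^sub>R v + t *\<^sub>R w" by simp
      with elim(2) have "\<bar>u (a + t *\<^sub>R v + t *\<^sub>R w) - u (a + t *\<^sub>R w) - u (a + t *\<^sub>R v) + u a - t\<^sup>2 * B v\<bar>
          \<le> e / 2 * t\<^sup>2"
        by simp
      with elim(1) have "\<bar>t\<^sup>2 * A w - t\<^sup>2 * B v\<bar> \<le> e / 2 * t\<^sup>2 + e / 2 * t\<^sup>2"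
        by linarith
      with elim(3) show ?case
        by (simp add: right_diff_distrib)
    qed
    then obtain t where "t > 0" "\<bar>t\<^sup>2 * (A w - B v)\<bar> \<le> e * t\<^sup>2"
      using eventually_happens'[OF trivial_limit_at_right_real] by blast
    then show ?thesis
      by (simp add: abs_mult)
  qed
  then have "\<bar>A w - B v\<bar> \<le> 0"
    by (rule field_le_epsilon)
  then show ?thesis by simp
qed

lemma has_derivative_grad:
  assumes "u differentiable (at z)"
  shows "(u has_derivative (\<lambda>h. inner (grad u z) h)) (at z)"
proof -
  let ?D = "frechet_derivative u (at z)"
  have D: "(u has_derivative ?D) (at z)"
    using assms by (simp add: frechet_derivative_works)
  interpret D: bounded_linear ?D
    using D by (rule has_derivative_bounded_linear)
  have "?D = (\<lambda>h. inner (grad u z) h)"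
  proof
    fix h
    have "?D (Re h *\<^sub>R 1 + Im h *\<^sub>R \<i>) = inner (grad u z) h"
      unfolding D.add D.scaleR by (simp add: grad_def inner_complex_def)
    moreover have "Re h *\<^sub>R 1 + Im h *\<^sub>R \<i> = h"
      by (simp add: complex_eq_iff)
    ultimately show "?D h = inner (grad u z) h" by simp
  qed
  with D show ?thesis by simp
qed

text \<open>The function is \<open>u_y + \<i> * u_x\<close>, the derivative of a holomorphic
  function with imaginary part \<open>u\<close>. Its Cauchy--Riemann equations are the symmetry of
  the mixed second derivatives and the Laplace equation.\<close>

lemma harmonic_on_imp_holomorphic:
  assumes harm: "harmonic_on \<Omega> u"
  shows "(\<lambda>z. \<i> * cnj (grad u z)) holomorphic_on \<Omega>"
proof -
  have op: "open \<Omega>" and du: "u differentiable_on \<Omega>"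
    and dd: "\<And>v. iter_dd [v] u differentiable_on \<Omega>"
    and lap: "\<And>z. z \<in> \<Omega> \<Longrightarrow> iter_dd [1, 1] u z + iter_dd [\<i>, \<i>] u z = 0"
    using harm by (auto simp: harmonic_on_def)
  have "\<exists>c. ((\<lambda>z. \<i> * cnj (grad u z)) has_field_derivative c) (at z)" if z: "z \<in> \<Omega>" for z
  proof -
    define A where "A = frechet_derivative (iter_dd [1] u) (at z)"
    define B where "B = frechet_derivative (iter_dd [\<i>] u) (at z)"
    have A: "((\<lambda>z. frechet_derivative u (at z) 1) has_derivative A) (at z)"
      using dd[of 1] z op unfolding A_def differentiable_on_def
      by (simp add: at_within_open[of _ \<Omega>] frechet_derivative_works)
    have B: "((\<lambda>z. frechet_derivative u (at z) \<i>) has_derivative B) (at z)"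
      using dd[of \<i>] z op unfolding B_def differentiable_on_def
      by (simp add: at_within_open[of _ \<Omega>] frechet_derivative_works)
    have Du: "(u has_derivative frechet_derivative u (at y)) (at y)" if "y \<in> \<Omega>" for y
      using du that op by (simp add: differentiable_on_def at_within_open[of _ \<Omega>] frechet_derivative_works)
    have sym: "A \<i> = B 1"
      by (rule symmetric_second_derivative[OF op z Du A B])
    have lapl: "B \<i> = - A 1"
      using lap[OF z] by (simp add: A_def B_def)
    interpret A: bounded_linear A
      using A by (rule has_derivative_bounded_linear)
    interpret B: bounded_linear B
      using B by (rule has_derivative_bounded_linear)
    have "(\<lambda>h. of_real (B h) + \<i> * of_real (A h)) = (*) (Complex (A \<i>) (A 1))"
    proof
      fix h :: complex
      have h: "Re h *\<^sub>R 1 + Im h *\<^sub>R \<i> = h"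
        by (simp add: complex_eq_iff)
      have "A h = Re h * A 1 + Im h * A \<i>"
        by (subst h[symmetric]) (simp only: A.add A.scaleR real_scaleR_def)
      moreover have "B h = Re h * B 1 + Im h * B \<i>"
        by (subst h[symmetric]) (simp only: B.add B.scaleR real_scaleR_def)
      ultimately show "of_real (B h) + \<i> * of_real (A h) = Complex (A \<i>) (A 1) * h"
        using sym lapl by (simp add: complex_eq_iff)
    qed
    moreover have "((\<lambda>z. of_real (frechet_derivative u (at z) \<i>) + \<i> * of_real (frechet_derivative u (at z) 1))
        has_derivative (\<lambda>h. of_real (B h) + \<i> * of_real (A h))) (at z)"
      by (intro derivative_intros A B bounded_linear.has_derivative[OF bounded_linear_of_real])
    moreover have "(\<lambda>z. \<i> * cnj (grad u z))
        = (\<lambda>z. of_real (frechet_derivative u (at z) \<i>) + \<i> * of_real (frechet_derivative u (at z) 1))"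
      by (simp add: grad_def complex_eq_iff fun_eq_iff)
    ultimately have "((\<lambda>z. \<i> * cnj (grad u z)) has_derivative (*) (Complex (A \<i>) (A 1))) (at z)"
      by simp
    then show ?thesis
      by (auto simp: has_field_derivative_def)
  qed
  then show ?thesis
    using op by (simp add: holomorphic_on_open)
qed

lemma harmonic_on_simply_connected_imp_Im:
  assumes harm: "harmonic_on \<Omega> u" and sc: "simply_connected \<Omega>"
  obtains F where "\<And>z. z \<in> \<Omega> \<Longrightarrow> (F has_field_derivative \<i> * cnj (grad u z)) (at z)"
    "\<And>z. z \<in> \<Omega> \<Longrightarrow> Im (F z) = u z"
proof -
  have op: "open \<Omega>" and du: "u differentiable_on \<Omega>"
    using harm by (auto simp: harmonic_on_def)
  have con: "connected \<Omega>"
    using sc by (rule simply_connected_imp_connected)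
  obtain h where h: "\<And>z. z \<in> \<Omega> \<Longrightarrow> (h has_field_derivative \<i> * cnj (grad u z)) (at z)"
    using sc harmonic_on_imp_holomorphic[OF harm] simply_connected_eq_global_primitive[OF op] by blast
  have "((\<lambda>z. Im (h z) - u z) has_derivative (\<lambda>x. 0)) (at z)" if z: "z \<in> \<Omega>" for z
  proof -
    have "((\<lambda>z. Im (h z)) has_derivative (\<lambda>x. Im (\<i> * cnj (grad u z) * x))) (at z)"
      using h[OF z] unfolding has_field_derivative_def
      by (rule bounded_linear.has_derivative[OF bounded_linear_Im])
    moreover have "u differentiable (at z)"
      using du z op by (simp add: differentiable_on_def at_within_open[of _ \<Omega>])
    ultimately have "((\<lambda>z. Im (h z) - u z) has_derivative
        (\<lambda>x. Im (\<i> * cnj (grad u z) * x) - inner (grad u z) x)) (at z)"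
      by (intro has_derivative_diff has_derivative_grad)
    then show ?thesis
      by (simp add: inner_complex_def)
  qed
  then have const: "Im (h y) - u y = Im (h z) - u z" if "y \<in> \<Omega>" "z \<in> \<Omega>" for y z
    using has_derivative_zero_unique_connected[OF op con, of "\<lambda>z. Im (h z) - u z" y z] that by blast
  \<comment> \<open>Choosing the constant instead of a base point spares a separate case for empty
    \<open>\<Omega>\<close>.\<close>
  define c where "c = (SOME c. \<forall>y\<in>\<Omega>. Im (h y) - u y = c)"
  have c: "\<forall>y\<in>\<Omega>. Im (h y) - u y = c"
    unfolding c_def by (rule someI_ex) (use const in blast)
  show ?thesis
  proof
    show "((\<lambda>z. h z - \<i> * of_real c) has_field_derivative \<i> * cnj (grad u z)) (at z)" if "z \<in> \<Omega>" for z
      using h[OF that] by (auto intro!: derivative_eq_intros)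
    show "Im (h z - \<i> * of_real c) = u z" if "z \<in> \<Omega>" for z
      using c that by (simp add: algebra_simps) 
  qed
qed

section \<open>Local structure at the boundary\<close>

text \<open>The lists \<open>[]\<close> and \<open>[v]\<close> in \<open>smooth_on\<close> give
  differentiability and continuity of each directional derivative. The directions \<open>1\<close>
  and \<open>\<i>\<close> already control the operator norm.\<close>

lemma smooth_on_locally_bounded_derivative:
  fixes \<psi> :: "complex \<Rightarrow> complex"
  assumes smooth: "smooth_on U \<psi>" and U: "open U" "z0 \<in> U"
  obtains r L where "r > 0" "L > 0" "ball z0 r \<subseteq> U"
    "\<And>z. z \<in> ball z0 r \<Longrightarrow> (\<psi> has_derivative frechet_derivative \<psi> (at z)) (at z)"
    "\<And>z. z \<in> ball z0 r \<Longrightarrow> onorm (frechet_derivative \<psi> (at z)) \<le> L"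
proof -
  have D: "(\<psi> has_derivative frechet_derivative \<psi> (at z)) (at z)" if "z \<in> U" for z
    using smooth[unfolded smooth_on_def, rule_format, of "[]"] that U
    by (simp add: differentiable_on_def at_within_open[of _ U] frechet_derivative_works)
  have cont: "isCont (\<lambda>z. frechet_derivative \<psi> (at z) v) z0" for v
    using smooth[unfolded smooth_on_def, rule_format, of "[v]"] U
    by (simp add: differentiable_on_def at_within_open[of _ U] differentiable_imp_continuous_within)
  obtain r0 where r0: "r0 > 0" "ball z0 r0 \<subseteq> U"
    using U open_contains_ball by blast
  have "\<exists>r>0. \<forall>z\<in>ball z0 r. norm (frechet_derivative \<psi> (at z) v) \<le> norm (frechet_derivative \<psi> (at z0) v) + 1" for v
  proof -
    obtain d where d: "d > 0" "\<And>z. dist z z0 < d \<Longrightarrow>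
        dist (frechet_derivative \<psi> (at z) v) (frechet_derivative \<psi> (at z0) v) < 1"
      using cont[of v] unfolding continuous_at_eps_delta by (metis zero_less_one)
    have "norm (frechet_derivative \<psi> (at z) v) \<le> norm (frechet_derivative \<psi> (at z0) v) + 1"
      if "z \<in> ball z0 d" for z
      using d(2)[of z] that norm_triangle_ineq2[of "frechet_derivative \<psi> (at z) v" "frechet_derivative \<psi> (at z0) v"]
      by (simp add: dist_norm norm_minus_commute)
    then show ?thesis using d by blast
  qed
  then obtain R where R: "\<And>v. R v > 0" "\<And>v z. z \<in> ball z0 (R v) \<Longrightarrow>
      norm (frechet_derivative \<psi> (at z) v) \<le> norm (frechet_derivative \<psi> (at z0) v) + 1"
    by metis
  define r where "r = min r0 (min (R 1) (R \<i>))"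
  define L where "L = (norm (frechet_derivative \<psi> (at z0) 1) + 1) + (norm (frechet_derivative \<psi> (at z0) \<i>) + 1)"
  show ?thesis
  proof
    show "r > 0" using r0 R by (simp add: r_def)
    show "L > 0" unfolding L_def by (intro add_pos_pos add_nonneg_pos) auto
    show "ball z0 r \<subseteq> U" using r0 by (auto simp: r_def)
    then show D': "(\<psi> has_derivative frechet_derivative \<psi> (at z)) (at z)" if "z \<in> ball z0 r" for z
      using D that by blast
    show "onorm (frechet_derivative \<psi> (at z)) \<le> L" if z: "z \<in> ball z0 r" for z
    proof (rule onorm_le)
      fix h :: complex
      interpret D: bounded_linear "frechet_derivative \<psi> (at z)"
        using D'[OF z] by (rule has_derivative_bounded_linear)
      have h: "Re h *\<^sub>R 1 + Im h *\<^sub>R \<i> = h"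
        by (simp add: complex_eq_iff)
      have "norm (frechet_derivative \<psi> (at z) h)
          = norm (Re h *\<^sub>R frechet_derivative \<psi> (at z) 1 + Im h *\<^sub>R frechet_derivative \<psi> (at z) \<i>)"
        by (subst h[symmetric]) (simp only: D.add D.scaleR)
      also have "\<dots> \<le> \<bar>Re h\<bar> * norm (frechet_derivative \<psi> (at z) 1) + \<bar>Im h\<bar> * norm (frechet_derivative \<psi> (at z) \<i>)"
        by (rule order_trans[OF norm_triangle_ineq]) simp
      also have "\<dots> \<le> norm h * (norm (frechet_derivative \<psi> (at z0) 1) + 1) + norm h * (norm (frechet_derivative \<psi> (at z0) \<i>) + 1)"
        using z R(2)[of z 1] R(2)[of z \<i>]
        by (intro add_mono mult_mono abs_Re_le_cmod abs_Im_le_cmod) (auto simp: r_def)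
      also have "\<dots> = L * norm h"
        by (simp add: L_def algebra_simps)
      finally show "norm (frechet_derivative \<psi> (at z) h) \<le> L * norm h" .
    qed
  qed
qed

text \<open>Straightening the boundary makes the domain locally convex, so that the mean value
  inequality applies upstairs.\<close>

lemma smooth_domain_boundary_linearization:
  assumes \<Omega>: "smooth_domain \<Omega>" and p: "p \<in> frontier \<Omega>"
    and F: "\<And>z. z \<in> \<Omega> \<Longrightarrow> (F has_field_derivative f z) (at z)"
    and g: "continuous_on (closure \<Omega>) g" "\<And>z. z \<in> \<Omega> \<Longrightarrow> g z = f z" and e: "e > 0"
  obtains \<rho> where "\<rho> > 0" "\<And>y z. y \<in> \<Omega> \<inter> ball p \<rho> \<Longrightarrow> z \<in> \<Omega> \<inter> ball p \<rho> \<Longrightarrow>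
    norm (F y - F z - g p * (y - z)) \<le> e * norm (y - z)"
proof -
  obtain \<epsilon> \<psi> D where \<epsilon>: "\<epsilon> > 0" and dif: "smooth_diffeo (ball p \<epsilon>) D \<psi>"
    and im: "\<psi> ` (ball p \<epsilon> \<inter> \<Omega>) = D \<inter> {w. Im w > 0}"
      "\<psi> ` (ball p \<epsilon> \<inter> frontier \<Omega>) = D \<inter> {w. Im w = 0}"
    using \<Omega> p unfolding smooth_domain_def by metis
  define \<xi> where "\<xi> = inv_into (ball p \<epsilon>) \<psi>"
  have oD: "open D" and imD: "\<psi> ` ball p \<epsilon> = D" and inj: "inj_on \<psi> (ball p \<epsilon>)"
    and sm: "smooth_on (ball p \<epsilon>) \<psi>" "smooth_on D \<xi>"
    using dif by (auto simp: smooth_diffeo_def \<xi>_def)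
  have \<xi>\<psi>: "\<xi> (\<psi> z) = z" if "z \<in> ball p \<epsilon>" for z
    using that inj by (simp add: \<xi>_def)
  have pin: "p \<in> ball p \<epsilon>" using \<epsilon> by simp
  then have w0D: "\<psi> p \<in> D" using imD by blast
  obtain r1 L1 where 1: "r1 > 0" "L1 > 0" "ball p r1 \<subseteq> ball p \<epsilon>"
    "\<And>z. z \<in> ball p r1 \<Longrightarrow> (\<psi> has_derivative frechet_derivative \<psi> (at z)) (at z)"
    "\<And>z. z \<in> ball p r1 \<Longrightarrow> onorm (frechet_derivative \<psi> (at z)) \<le> L1"
    using smooth_on_locally_bounded_derivative[OF sm(1) open_ball pin] by metis
  obtain r2 L2 where 2: "r2 > 0" "L2 > 0" "ball (\<psi> p) r2 \<subseteq> D"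
    "\<And>z. z \<in> ball (\<psi> p) r2 \<Longrightarrow> (\<xi> has_derivative frechet_derivative \<xi> (at z)) (at z)"
    "\<And>z. z \<in> ball (\<psi> p) r2 \<Longrightarrow> onorm (frechet_derivative \<xi> (at z)) \<le> L2"
    using smooth_on_locally_bounded_derivative[OF sm(2) oD w0D] by metis
  have lip1: "norm (\<psi> y - \<psi> z) \<le> L1 * norm (y - z)" if "y \<in> ball p r1" "z \<in> ball p r1" for y z
    by (rule differentiable_bound[OF convex_ball has_derivative_at_withinI[OF 1(4)] 1(5) that])
  have lip2: "norm (\<xi> y - \<xi> z) \<le> L2 * norm (y - z)" if "y \<in> ball (\<psi> p) r2" "z \<in> ball (\<psi> p) r2" for y z
    by (rule differentiable_bound[OF convex_ball has_derivative_at_withinI[OF 2(4)] 2(5) that])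
  \<comment> \<open>The final Lipschitz constant will be \<open>\<eta>\<close> times those of
    \<open>\<xi>\<close> and \<open>\<psi>\<close>, that is
    \<open>\<eta> * L2 * L1 = e\<close>.\<close>
  define \<eta> where "\<eta> = e / (L1 * L2)"
  have \<eta>: "\<eta> > 0" using e 1 2 by (simp add: \<eta>_def)
  have "p \<in> closure \<Omega>" using p by (simp add: frontier_def)
  then obtain \<delta> where \<delta>: "\<delta> > 0" "\<And>z. z \<in> closure \<Omega> \<Longrightarrow> dist z p < \<delta> \<Longrightarrow> dist (g z) (g p) < \<eta>"
    using g(1) \<eta> unfolding continuous_on_iff by metis
  define r3 where "r3 = min r2 (\<delta> / L2)"
  have r3: "r3 > 0" using 2 \<delta> by (simp add: r3_def)
  define W where "W = ball (\<psi> p) r3 \<inter> {w. Im w > 0}"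
  have W2: "w \<in> ball (\<psi> p) r2" if "w \<in> W" for w
    using that by (auto simp: W_def r3_def)
  have convW: "convex W"
    unfolding W_def by (intro convex_Int convex_ball convex_halfspace_Im_gt)
  have W\<Omega>: "\<xi> w \<in> \<Omega>" if "w \<in> W" for w
  proof -
    have "w \<in> \<psi> ` (ball p \<epsilon> \<inter> \<Omega>)"
      using im(1) 2(3) W2[OF that] that by (auto simp: W_def)
    then show ?thesis using \<xi>\<psi> by auto
  qed
  have Wg: "norm (f (\<xi> w) - g p) \<le> \<eta>" if "w \<in> W" for w
  proof -
    have "norm (\<xi> w - \<xi> (\<psi> p)) \<le> L2 * norm (w - \<psi> p)"
      using W2[OF that] 2 by (intro lip2) auto
    also have "\<dots> < L2 * (\<delta> / L2)"
      using that 2 by (intro mult_strict_left_mono) (auto simp: W_def r3_def dist_norm norm_minus_commute)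
    finally have "dist (\<xi> w) p < \<delta>"
      using 2 \<xi>\<psi>[OF pin] by (simp add: dist_norm)
    moreover have "\<xi> w \<in> closure \<Omega>" using W\<Omega>[OF that] closure_subset by blast
    ultimately have "dist (g (\<xi> w)) (g p) < \<eta>"
      by (intro \<delta>)
    then show ?thesis
      using g(2)[OF W\<Omega>[OF that]] by (simp add: dist_norm)
  qed
  \<comment> \<open>The deviation of \<open>F\<close> from its linear part, read in the chart: its
    derivative is at most \<open>\<eta> * L2\<close> on the convex half-ball
    \<open>W\<close>.\<close>
  define k where "k w = F (\<xi> w) - g p * \<xi> w" for w
  have dk: "(k has_derivative (\<lambda>h. (f (\<xi> w) - g p) * frechet_derivative \<xi> (at w) h)) (at w within W)"
    and ok: "onorm (\<lambda>h. (f (\<xi> w) - g p) * frechet_derivative \<xi> (at w) h) \<le> \<eta> * L2"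
    if w: "w \<in> W" for w
  proof -
    have D\<xi>: "(\<xi> has_derivative frechet_derivative \<xi> (at w)) (at w)"
      using W2[OF w] by (rule 2)
    have "((\<lambda>w. F (\<xi> w)) has_derivative (\<lambda>h. f (\<xi> w) * frechet_derivative \<xi> (at w) h)) (at w)"
      by (rule has_derivative_compose[OF D\<xi> F[OF W\<Omega>[OF w], unfolded has_field_derivative_def]])
    then have "(k has_derivative (\<lambda>h. f (\<xi> w) * frechet_derivative \<xi> (at w) h - g p * frechet_derivative \<xi> (at w) h)) (at w)"
      unfolding k_def by (intro has_derivative_diff has_derivative_mult_right D\<xi>)
    then show "(k has_derivative (\<lambda>h. (f (\<xi> w) - g p) * frechet_derivative \<xi> (at w) h)) (at w within W)"
      unfolding left_diff_distrib by (rule has_derivative_at_withinI)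
    show "onorm (\<lambda>h. (f (\<xi> w) - g p) * frechet_derivative \<xi> (at w) h) \<le> \<eta> * L2"
    proof (rule onorm_le)
      fix h
      have "norm (frechet_derivative \<xi> (at w) h) \<le> onorm (frechet_derivative \<xi> (at w)) * norm h"
        by (rule onorm[OF has_derivative_bounded_linear[OF D\<xi>]])
      also have "\<dots> \<le> L2 * norm h"
        using 2(5)[OF W2[OF w]] by (intro mult_right_mono) auto
      finally show "norm ((f (\<xi> w) - g p) * frechet_derivative \<xi> (at w) h) \<le> \<eta> * L2 * norm h"
        unfolding norm_mult mult.assoc by (rule mult_mono[OF Wg[OF w]]) (use \<eta> in auto)
    qed
  qed
  \<comment> \<open>The first bound lets the Lipschitz estimate of \<open>\<psi>\<close> apply, the
    second puts the image under \<open>\<psi>\<close> within \<open>r3\<close> of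
    \<open>\<psi> p\<close>.\<close>
  define \<rho> where "\<rho> = min r1 (r3 / L1)"
  have in_W: "\<psi> z \<in> W \<and> \<xi> (\<psi> z) = z" if z: "z \<in> \<Omega> \<inter> ball p \<rho>" for z
  proof -
    have z1: "z \<in> ball p r1" using z by (simp add: \<rho>_def)
    then have z\<epsilon>: "z \<in> ball p \<epsilon>" using 1 by blast
    have "norm (\<psi> p - \<psi> z) \<le> L1 * norm (p - z)"
      using z1 1 by (intro lip1) auto
    also have "\<dots> < L1 * (r3 / L1)"
      using z 1 by (intro mult_strict_left_mono) (auto simp: \<rho>_def dist_norm)
    finally have "dist (\<psi> p) (\<psi> z) < r3" using 1 by (simp add: dist_norm)
    moreover have "Im (\<psi> z) > 0" using im(1) z z\<epsilon> by blast
    ultimately show ?thesis using \<xi>\<psi>[OF z\<epsilon>] by (simp add: W_def)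
  qed
  show ?thesis
  proof
    show "\<rho> > 0" using 1 r3 by (simp add: \<rho>_def)
    show "norm (F y - F z - g p * (y - z)) \<le> e * norm (y - z)"
      if y: "y \<in> \<Omega> \<inter> ball p \<rho>" and z: "z \<in> \<Omega> \<inter> ball p \<rho>" for y z
    proof -
      have "norm (k (\<psi> y) - k (\<psi> z)) \<le> \<eta> * L2 * norm (\<psi> y - \<psi> z)"
        by (rule differentiable_bound[OF convW dk ok]) (use in_W y z in auto)
      also have "\<dots> \<le> \<eta> * L2 * (L1 * norm (y - z))"
        using \<eta> 2 y z by (intro mult_left_mono lip1) (auto simp: \<rho>_def)
      also have "\<dots> = e * norm (y - z)"
        using 1 2 by (simp add: \<eta>_def)
      finally show ?thesis
        using in_W[OF y] in_W[OF z] by (simp add: k_def algebra_simps)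
    qed
  qed
qed

text \<open>A chart maps a full ball onto an open set around a real point, so some point of the ball
  goes below the real line; it lies neither in the domain nor on its frontier.\<close>

lemma smooth_domain_exterior_point:
  assumes \<Omega>: "smooth_domain \<Omega>"
  obtains q where "q \<notin> closure \<Omega>"
proof -
  obtain p where p: "p \<in> frontier \<Omega>" using \<Omega> by (auto simp: smooth_domain_def)
  obtain \<epsilon> \<psi> D where \<epsilon>: "\<epsilon> > 0" and dif: "smooth_diffeo (ball p \<epsilon>) D \<psi>"
    and im: "\<psi> ` (ball p \<epsilon> \<inter> \<Omega>) = D \<inter> {w. Im w > 0}"
      "\<psi> ` (ball p \<epsilon> \<inter> frontier \<Omega>) = D \<inter> {w. Im w = 0}"
    using \<Omega> p unfolding smooth_domain_def by metis
  have oD: "open D" and imD: "\<psi> ` ball p \<epsilon> = D"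
    using dif by (auto simp: smooth_diffeo_def)
  have w0: "\<psi> p \<in> D" "Im (\<psi> p) = 0"
    using im(2) p \<epsilon> by auto
  obtain r where r: "r > 0" "ball (\<psi> p) r \<subseteq> D"
    using oD w0 open_contains_ball by blast
  have "\<psi> p - \<i> * of_real (r / 2) \<in> ball (\<psi> p) r"
    using r by (simp add: dist_norm norm_mult)
  then obtain q where q: "q \<in> ball p \<epsilon>" "\<psi> q = \<psi> p - \<i> * of_real (r / 2)"
    using r imD by (metis (no_types, lifting) imageE subsetD)
  have "Im (\<psi> q) < 0" using q(2) w0 r by simp
  have "\<psi> q \<notin> \<psi> ` (ball p \<epsilon> \<inter> \<Omega>)" "\<psi> q \<notin> \<psi> ` (ball p \<epsilon> \<inter> frontier \<Omega>)"
    unfolding im using \<open>Im (\<psi> q) < 0\<close> by auto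
  then have "q \<notin> \<Omega>" "q \<notin> frontier \<Omega>"
    using q(1) by blast+
  moreover have "interior \<Omega> \<subseteq> \<Omega>" by (rule interior_subset)
  ultimately have "q \<notin> closure \<Omega>"
    unfolding frontier_def by blast
  then show ?thesis by (rule that)
qed

section \<open>Boundary values of the Riemann map\<close>

text \<open>The two Lipschitz bounds make \<open>F\<close> injective near \<open>p\<close> and give
  it a limit \<open>t\<close>, which is real. That \<open>F\<close> covers a whole half-disc about
  \<open>t\<close> follows by connectedness: the covered part is open, closed and non-empty.\<close>

lemma local_boundary_inverse:
  assumes op: "open \<Omega>" and holF: "F holomorphic_on \<Omega>" and p: "p \<in> frontier \<Omega>" and \<rho>: "\<rho> > 0"
    and lower: "\<And>y z. y \<in> \<Omega> \<inter> ball p \<rho> \<Longrightarrow> z \<in> \<Omega> \<inter> ball p \<rho> \<Longrightarrow> norm (y - z) \<le> 2 * norm (F y - F z)"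
    and upper: "\<And>y z. y \<in> \<Omega> \<inter> ball p \<rho> \<Longrightarrow> z \<in> \<Omega> \<inter> ball p \<rho> \<Longrightarrow> norm (F y - F z) \<le> 2 * norm (y - z)"
    and pos: "\<And>z. z \<in> \<Omega> \<Longrightarrow> Im (F z) > 0"
    and bd: "\<And>q. q \<in> frontier \<Omega> \<Longrightarrow> ((\<lambda>z. Im (F z)) \<longlongrightarrow> 0) (at q within \<Omega>)"
  obtains t r \<Psi> \<delta> where "Im t = 0" "r > 0" "\<delta> > 0" "(F \<longlongrightarrow> t) (at p within \<Omega>)"
    "\<Psi> holomorphic_on ball t r \<inter> {w. Im w > 0}"
    "\<And>w. w \<in> ball t r \<Longrightarrow> Im w > 0 \<Longrightarrow> \<Psi> w \<in> \<Omega> \<and> F (\<Psi> w) = w \<and> norm (\<Psi> w - p) \<le> 2 * norm (w - t)"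
    "\<And>z. z \<in> \<Omega> \<inter> ball p \<delta> \<Longrightarrow> F z \<in> ball t r \<and> \<Psi> (F z) = z"
proof -
  let ?B = "\<Omega> \<inter> ball p \<rho>"
  have oB: "open ?B" using op by (simp add: open_Int)
  have pcl: "p \<in> closure \<Omega>" and pn: "p \<notin> \<Omega>"
    using p op by (auto simp: frontier_def interior_open)
  have nb: "at p within \<Omega> \<noteq> bot"
    using pcl pn by (auto simp: trivial_limit_within closure_def)
  have atB: "at p within ?B = at p within \<Omega>"
    by (rule at_within_nhd[of _ "ball p \<rho>"]) (use \<rho> in auto)
  have pB: "p \<in> closure ?B"
    using nb pn unfolding atB[symmetric] by (auto simp: trivial_limit_within closure_def)
  have uc: "uniformly_continuous_on ?B F"
    by (rule lipschitz_on_uniformly_continuous[of 2], rule lipschitz_onI) (use upper in \<open>auto simp: dist_norm\<close>)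
  obtain t where t: "(F \<longlongrightarrow> t) (at p within \<Omega>)"
    using uniformly_continuous_on_extension_at_closure[OF uc pB] unfolding atB by blast
  have Im_t: "Im t = 0"
    using tendsto_unique[OF nb tendsto_Im[OF t] bd[OF p]] .
  have evB: "\<forall>\<^sub>F y in at p within \<Omega>. y \<in> ?B"
    using \<rho> unfolding eventually_at by (auto simp: dist_commute)
  have low_p: "norm (z - p) \<le> 2 * norm (F z - t)" if "z \<in> ?B" for z
  proof (rule tendsto_le[OF nb])
    show "((\<lambda>y. 2 * norm (F z - F y)) \<longlongrightarrow> 2 * norm (F z - t)) (at p within \<Omega>)"
      by (intro tendsto_intros t)
    show "((\<lambda>y. norm (z - y)) \<longlongrightarrow> norm (z - p)) (at p within \<Omega>)"
      by (intro tendsto_intros)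
    show "\<forall>\<^sub>F y in at p within \<Omega>. norm (z - y) \<le> 2 * norm (F z - F y)"
      using evB by eventually_elim (use lower that in auto)
  qed
  have up_p: "norm (F z - t) \<le> 2 * norm (z - p)" if "z \<in> ?B" for z
  proof (rule tendsto_le[OF nb])
    show "((\<lambda>y. norm (F z - F y)) \<longlongrightarrow> norm (F z - t)) (at p within \<Omega>)"
      by (intro tendsto_intros t)
    show "((\<lambda>y. 2 * norm (z - y)) \<longlongrightarrow> 2 * norm (z - p)) (at p within \<Omega>)"
      by (intro tendsto_intros)
    show "\<forall>\<^sub>F y in at p within \<Omega>. norm (F z - F y) \<le> 2 * norm (z - y)"
      using evB by eventually_elim (use upper that in auto)
  qed
  have injF: "inj_on F ?B"
  proof (rule inj_onI)
    fix y z assume "y \<in> ?B" "z \<in> ?B" "F y = F z"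
    then show "y = z" using lower[of y z] by simp
  qed
  have holB: "F holomorphic_on ?B"
    using holF by (rule holomorphic_on_subset) auto
  obtain \<Psi> where \<Psi>: "\<Psi> holomorphic_on (F ` ?B)" "\<And>z. z \<in> ?B \<Longrightarrow> \<Psi> (F z) = z"
    using holomorphic_has_inverse[OF holB oB injF] by metis
  \<comment> \<open>By the lower bound, preimages of points within \<open>r\<close> of
    \<open>t\<close> lie within \<open>\<rho> / 2\<close> of \<open>p\<close>: a compact set inside
    the ball where the bounds hold.\<close>
  define r where "r = \<rho> / 4"
  have r: "r > 0" using \<rho> by (simp add: r_def)
  define S where "S = ball t r \<inter> {w. Im w > 0}"
  define T where "T = F ` ?B \<inter> S"
  have "connected S"
    unfolding S_def by (intro convex_connected convex_Int convex_ball convex_halfspace_Im_gt)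
  moreover have "openin (top_of_set S) T"
  proof -
    have "open (F ` ?B)"
      by (rule open_mapping_thm3[OF holB oB injF])
    then show ?thesis
      unfolding T_def using openin_open_Int[of "F ` ?B" S] by (simp add: Int_commute)
  qed
  moreover have "closedin (top_of_set S) T"
  proof -
    have "w \<in> T" if w: "w \<in> S" "w \<in> closure T" for w
    proof -
      obtain x where x: "\<And>n. x n \<in> T" "x \<longlonglongrightarrow> w"
        using w(2) unfolding closure_sequential by blast
      have "\<exists>z. z \<in> ?B \<and> F z = x n" for n
        using x(1)[of n] by (auto simp: T_def)
      then obtain z where z: "\<And>n. z n \<in> ?B" "\<And>n. F (z n) = x n" by metis
      have zb: "z n \<in> cball p (\<rho> / 2)" for n
      proof -
        have "norm (x n - t) < r"
          using x(1)[of n] by (simp add: T_def S_def dist_norm norm_minus_commute)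
        then show ?thesis
          using low_p[OF z(1)[of n]] z(2)[of n] by (simp add: r_def dist_norm norm_minus_commute)
      qed
      then obtain l s where l: "l \<in> cball p (\<rho> / 2)" "strict_mono (s :: nat \<Rightarrow> nat)" "(z \<circ> s) \<longlonglongrightarrow> l"
        using compact_cball[of p "\<rho> / 2"] unfolding compact_def by meson
      have xs: "(\<lambda>n. F ((z \<circ> s) n)) \<longlonglongrightarrow> w"
        using LIMSEQ_subseq_LIMSEQ[OF x(2) l(2)] z(2) by (simp add: o_def)
      have zs: "(z \<circ> s) n \<in> \<Omega>" for n using z(1) by auto
      have lcl: "l \<in> closure \<Omega>"
        unfolding closure_sequential using zs l(3) by blast
      \<comment> \<open>A cluster point on the frontier would force \<open>Im w = 0\<close>, since
        \<open>Im F\<close> tends to 0 there.\<close>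
      have "l \<in> \<Omega>"
      proof (rule ccontr)
        assume nl: "l \<notin> \<Omega>"
        then have "l \<in> frontier \<Omega>"
          using lcl op by (simp add: frontier_def interior_open)
        then have "((\<lambda>z. Im (F z)) \<longlongrightarrow> 0) (at l within \<Omega>)" by (rule bd)
        moreover have "filterlim (z \<circ> s) (at l within \<Omega>) sequentially"
          unfolding filterlim_at using l(3) zs nl by (auto intro!: always_eventually)
        ultimately have "(\<lambda>n. Im (F ((z \<circ> s) n))) \<longlonglongrightarrow> 0"
          by (rule filterlim_compose)
        then have "Im w = 0"
          using LIMSEQ_unique[OF tendsto_Im[OF xs]] by simp
        then show False using w(1) by (simp add: S_def)
      qed
      then have "isCont F l"
        using holomorphic_on_imp_continuous_on[OF holF] continuous_on_eq_continuous_at[OF op] by blast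
      then have "(\<lambda>n. F ((z \<circ> s) n)) \<longlonglongrightarrow> F l"
        using l(3) by (rule isCont_tendsto_compose)
      then have "F l = w" using LIMSEQ_unique xs by blast
      moreover have "l \<in> ?B"
        using \<open>l \<in> \<Omega>\<close> l(1) \<rho> by auto
      ultimately show ?thesis using w(1) by (auto simp: T_def)
    qed
    moreover have "T \<subseteq> S" by (simp add: T_def)
    ultimately have "T = S \<inter> closure T"
      using closure_subset by blast
    then show ?thesis using closedin_closed by blast
  qed
  moreover have "T \<noteq> {}"
  proof -
    have "\<forall>\<^sub>F z in at p within \<Omega>. z \<in> ?B \<and> F z \<in> ball t r"
      using evB tendstoD[OF t r] by eventually_elim (simp add: dist_commute)
    then obtain z where "z \<in> ?B" "F z \<in> ball t r"
      using eventually_happens'[OF nb] by blast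
    then have "F z \<in> T" using pos by (auto simp: T_def S_def)
    then show ?thesis by blast
  qed
  ultimately have "T = S"
    using connected_clopen by blast
  then have SF: "S \<subseteq> F ` ?B" by (auto simp: T_def)
  show ?thesis
  proof
    show "Im t = 0" "(F \<longlongrightarrow> t) (at p within \<Omega>)" "r > 0" by fact+
    show "min \<rho> (r / 2) > 0" using \<rho> r by simp
    show "\<Psi> holomorphic_on ball t r \<inter> {w. Im w > 0}"
      using \<Psi>(1) SF unfolding S_def by (rule holomorphic_on_subset)
    show "\<Psi> w \<in> \<Omega> \<and> F (\<Psi> w) = w \<and> norm (\<Psi> w - p) \<le> 2 * norm (w - t)"
      if w: "w \<in> ball t r" "Im w > 0" for w
    proof -
      have "w \<in> F ` ?B" using SF w by (auto simp: S_def)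
      then obtain z where "z \<in> ?B" "w = F z" by blast
      then show ?thesis using \<Psi>(2) low_p by auto
    qed
    show "F z \<in> ball t r \<and> \<Psi> (F z) = z" if z: "z \<in> \<Omega> \<inter> ball p (min \<rho> (r / 2))" for z
    proof -
      have zB: "z \<in> ?B" using z by auto
      have "norm (F z - t) \<le> 2 * norm (z - p)" by (rule up_p[OF zB])
      also have "\<dots> < r" using z by (simp add: dist_norm norm_minus_commute)
      finally show ?thesis
        using \<Psi>(2)[OF zB] by (simp add: dist_norm norm_minus_commute)
    qed
  qed
qed

text \<open>In the coordinate \<open>w = F z\<close> the Riemann map is \<open>q\<close>, and
  \<open>norm (q w)\<close> tends to 1 at the real diameter. So the imaginary part of
  \<open>- \<i> * log q\<close> tends to 0 and this function reflects; its exponential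
  \<open>\<xi>\<close> extends \<open>q\<close> across \<open>t\<close>, with
  \<open>\<zeta> = \<xi> t\<close>. Continuity of \<open>\<xi>\<close> gives the limit of
  \<open>\<psi>\<close>, openness of \<open>\<xi>\<close> that of \<open>\<phi>\<close>.\<close>

lemma conformal_boundary_correspondence:
  assumes op: "open \<Omega>" and holF: "F holomorphic_on \<Omega>" 
    and pos: "\<And>z. z \<in> \<Omega> \<Longrightarrow> Im (F z) > 0"
    and t: "Im t = 0" and r: "r > 0" and \<delta>: "\<delta> > 0" and Ft: "(F \<longlongrightarrow> t) (at p within \<Omega>)"
    and hol\<Psi>: "\<Psi> holomorphic_on ball t r \<inter> {w. Im w > 0}"
    and \<Psi>: "\<And>w. w \<in> ball t r \<Longrightarrow> Im w > 0 \<Longrightarrow> \<Psi> w \<in> \<Omega> \<and> F (\<Psi> w) = w \<and> norm (\<Psi> w - p) \<le> 2 * norm (w - t)"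
    and \<Psi>F: "\<And>z. z \<in> \<Omega> \<inter> ball p \<delta> \<Longrightarrow> F z \<in> ball t r \<and> \<Psi> (F z) = z"
    and hol\<psi>: "\<psi> holomorphic_on \<Omega>" and hol\<phi>: "\<phi> holomorphic_on ball 0 1"
    and \<psi>: "\<And>z. z \<in> \<Omega> \<Longrightarrow> norm (\<psi> z) < 1 \<and> \<phi> (\<psi> z) = z"
    and \<phi>: "\<And>w. norm w < 1 \<Longrightarrow> \<phi> w \<in> \<Omega> \<and> \<psi> (\<phi> w) = w"
  obtains \<zeta> where "norm \<zeta> = 1" "(\<psi> \<longlongrightarrow> \<zeta>) (at p within \<Omega>)" "(\<phi> \<longlongrightarrow> p) (at \<zeta> within ball 0 1)"
proof -
  let ?H = "{w. Im w > 0}"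
  have z0: "\<phi> 0 \<in> \<Omega>" using \<phi>[of 0] by simp
  \<comment> \<open>The map \<open>q\<close> can vanish only at \<open>F (\<phi> 0)\<close>; the
    smaller radius excludes this point, so that \<open>q\<close> has a logarithm.\<close>
  define r' where "r' = min r (norm (F (\<phi> 0) - t))"
  have "F (\<phi> 0) \<noteq> t" using pos[OF z0] t by auto
  then have r': "r' > 0" "r' \<le> r" using r by (auto simp: r'_def)
  define S where "S = ball t r' \<inter> ?H"
  define q where "q w = \<psi> (\<Psi> w)" for w
  have \<Psi>S: "\<Psi> w \<in> \<Omega> \<and> F (\<Psi> w) = w \<and> norm (\<Psi> w - p) \<le> 2 * norm (w - t)" if "w \<in> S" for w
    using \<Psi>[of w] that r' by (simp add: S_def)
  have holq: "q holomorphic_on S"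
    unfolding q_def
    by (rule holomorphic_on_compose_gen[OF holomorphic_on_subset[OF hol\<Psi>] hol\<psi>, unfolded o_def])
      (use r' \<Psi>S in \<open>auto simp: S_def\<close>)
  have qnz: "q w \<noteq> 0" if w: "w \<in> S" for w
  proof
    assume "q w = 0"
    then have "\<Psi> w = \<phi> 0" using \<psi>[of "\<Psi> w"] \<Psi>S[OF w] by (simp add: q_def)
    then have "w = F (\<phi> 0)" using \<Psi>S[OF w] by simp
    then show False using w by (simp add: S_def r'_def dist_norm norm_minus_commute)
  qed
  have convS: "convex S"
    unfolding S_def by (intro convex_Int convex_ball convex_halfspace_Im_gt)
  have oS: "open S"
    unfolding S_def by (intro open_Int open_ball open_halfspace_Im_gt)
  define w1 where "w1 = t + \<i> * of_real (r' / 2)"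
  have "w1 \<in> S" using r' t by (simp add: w1_def S_def dist_norm norm_mult)
  then obtain l where l: "l holomorphic_on S" "\<And>w. w \<in> S \<Longrightarrow> exp (l w) = q w"
    using holomorphic_logarithm_exists[OF convS oS holq qnz] by metis
  define f where "f w = - \<i> * l w" for w
  have holf: "f holomorphic_on ball t r' \<inter> ?H"
    unfolding f_def S_def[symmetric] by (intro holomorphic_intros l)
  have Im_f: "Im (f w) = - ln (norm (q w))" if "w \<in> S" for w
    by (simp add: f_def flip: l(2)[OF that])
  have q1: "norm (q w) < 1" if "w \<in> S" for w
    using \<psi>[of "\<Psi> w"] \<Psi>S[OF that] by (simp add: q_def)
  have limf: "((\<lambda>w. Im (f w)) \<longlongrightarrow> 0) (at x within ?H)" if x: "x \<in> ball t r'" "Im x = 0" for x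
  proof -
    have evS: "\<forall>\<^sub>F w in at x within ?H. w \<in> S"
    proof -
      have "\<forall>\<^sub>F w in at x within ?H. w \<in> ball t r'"
        using x(1) by (intro eventually_at_topological[THEN iffD2]) (auto intro!: exI[of _ "ball t r'"])
      moreover have "\<forall>\<^sub>F w in at x within ?H. w \<in> ?H"
        by (auto simp: eventually_at_topological)
      ultimately show ?thesis by eventually_elim (simp add: S_def)
    qed
    have "((\<lambda>w. norm (q w)) \<longlongrightarrow> 1) (at x within ?H)"
    proof (rule tendstoI)
      fix e :: real assume e: "e > 0"
      \<comment> \<open>If \<open>norm (q w) \<le> 1 - e\<close>, then \<open>\<Psi> w\<close> lies
        in the compact \<open>?K\<close>, on which \<open>Im F\<close> has a positive minimum; but
        \<open>Im (F (\<Psi> w)) = Im w\<close> tends to 0. For \<open>e > 1\<close> the set is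
        empty and any \<open>c\<close> will do.\<close>
      let ?K = "\<phi> ` cball 0 (1 - e)"
      have sub: "cball 0 (1 - e) \<subseteq> ball (0::complex) 1" using e by auto
      have K\<Omega>: "?K \<subseteq> \<Omega>" using \<phi> sub by auto
      have K: "compact ?K"
        by (rule compact_continuous_image[OF continuous_on_subset[OF holomorphic_on_imp_continuous_on[OF hol\<phi>] sub]
              compact_cball])
      have "continuous_on ?K (\<lambda>z. Im (F z))"
        by (rule continuous_on_Im[OF continuous_on_subset[OF holomorphic_on_imp_continuous_on[OF holF] K\<Omega>]])
      then have compK: "compact ((\<lambda>z. Im (F z)) ` ?K)"
        using K by (rule compact_continuous_image)
      obtain c where c: "c > 0" "\<And>z. z \<in> ?K \<Longrightarrow> c \<le> Im (F z)"
      proof (cases "?K = {}")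
        case True
        then show ?thesis using that[of 1] by auto
      next
        case False
        then obtain y where "y \<in> (\<lambda>z. Im (F z)) ` ?K" "\<And>v. v \<in> (\<lambda>z. Im (F z)) ` ?K \<Longrightarrow> y \<le> v"
          using compact_attains_inf[OF compK] by blast
        then show ?thesis using that[of y] pos K\<Omega> by blast
      qed
      have "((\<lambda>w. Im w) \<longlongrightarrow> Im x) (at x within ?H)"
        by (intro tendsto_intros)
      then have "\<forall>\<^sub>F w in at x within ?H. Im w < c"
        using x c by (intro order_tendstoD(2)) auto
      with evS show "\<forall>\<^sub>F w in at x within ?H. dist (norm (q w)) 1 < e"
      proof eventually_elim
        case (elim w)
        have "\<not> norm (q w) \<le> 1 - e"
        proof
          assume "norm (q w) \<le> 1 - e"
          then have "\<phi> (q w) \<in> ?K" by auto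
          moreover have "\<phi> (q w) = \<Psi> w" using \<psi>[of "\<Psi> w"] \<Psi>S[OF elim(1)] by (simp add: q_def)
          ultimately show False using c(2)[of "\<Psi> w"] \<Psi>S[OF elim(1)] elim(2) by simp
        qed
        then show ?case using q1[OF elim(1)] by (simp add: dist_real_def)
      qed
    qed
    then have "((\<lambda>w. - ln (norm (q w))) \<longlongrightarrow> - ln 1) (at x within ?H)"
      by (intro tendsto_intros) auto
    moreover have "\<forall>\<^sub>F w in at x within ?H. - ln (norm (q w)) = Im (f w)"
      using evS by eventually_elim (simp add: Im_f)
    ultimately show ?thesis
      using Lim_transform_eventually by fastforce
  qed
  have cnj_ball: "cnj w \<in> ball t r'" if "w \<in> ball t r'" for w
  proof -
    have "t - cnj w = cnj (t - w)" using t by (simp add: complex_eq_iff)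
    then show ?thesis
      using that by (metis complex_mod_cnj dist_norm mem_ball)
  qed
  then have "cnj ` ball t r' \<subseteq> ball t r'" by blast
  then obtain g where g: "g holomorphic_on ball t r'" "\<And>w. w \<in> ball t r' \<Longrightarrow> Im w > 0 \<Longrightarrow> g w = f w"
    "\<And>w. w \<in> ball t r' \<Longrightarrow> g (cnj w) = cnj (g w)"
    using real_boundary_extension[OF open_ball _ holf] limf by metis
  define \<xi> where "\<xi> w = exp (\<i> * g w)" for w
  have hol\<xi>: "\<xi> holomorphic_on ball t r'"
    unfolding \<xi>_def by (intro holomorphic_intros g)
  have \<xi>q: "\<xi> w = q w" if "w \<in> S" for w
    using that l(2)[OF that] g(2)[of w] by (simp add: \<xi>_def S_def f_def)
  \<comment> \<open>Consequently a point near \<open>t\<close> that \<open>\<xi>\<close> sends into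
    the open unit disc lies in the upper half, where \<open>\<xi> = q\<close> can be
    inverted.\<close>
  have \<xi>_ge: "norm (\<xi> w) \<ge> 1" if w: "w \<in> ball t r'" "Im w \<le> 0" for w
  proof (cases "Im w = 0")
    case True
    then have "cnj w = w" by (simp add: complex_eq_iff)
    then have "Im (g w) = 0" using arg_cong[OF g(3)[OF w(1)], of Im] by simp
    then show ?thesis by (simp add: \<xi>_def)
  next
    case False
    then have S: "cnj w \<in> S" using w cnj_ball by (simp add: S_def)
    have "Im (g w) = - Im (f (cnj w))"
      using g(2)[of "cnj w"] arg_cong[OF g(3)[OF w(1)], of Im] S by (simp add: S_def)
    also have "\<dots> = ln (norm (q (cnj w)))" using Im_f[OF S] by simp
    also have "\<dots> < 0" using q1[OF S] qnz[OF S] by simp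
    finally show ?thesis by (simp add: \<xi>_def)
  qed
  have \<xi>t: "norm (\<xi> t) = 1"
  proof -
    have "cnj t = t" using t by (simp add: complex_eq_iff)
    then have "Im (g t) = 0" using arg_cong[OF g(3)[of t], of Im] r' by simp
    then show ?thesis by (simp add: \<xi>_def)
  qed
  have nc: "\<not> \<xi> constant_on ball t r'"
  proof
    assume "\<xi> constant_on ball t r'"
    then have "\<xi> w1 = \<xi> t"
      using \<open>w1 \<in> S\<close> r' by (auto simp: constant_on_def S_def)
    then show False using \<xi>t \<xi>q[OF \<open>w1 \<in> S\<close>] q1[OF \<open>w1 \<in> S\<close>] by simp
  qed
  show ?thesis
  proof
    show "norm (\<xi> t) = 1" by (rule \<xi>t)
    have "isCont \<xi> t"
      using holomorphic_on_imp_continuous_on[OF hol\<xi>] r'(1) continuous_on_eq_continuous_at[OF open_ball]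
      by (metis centre_in_ball)
    then have "((\<lambda>z. \<xi> (F z)) \<longlongrightarrow> \<xi> t) (at p within \<Omega>)"
      using Ft by (rule isCont_tendsto_compose)
    moreover have "\<forall>\<^sub>F z in at p within \<Omega>. \<xi> (F z) = \<psi> z"
    proof -
      have "\<forall>\<^sub>F z in at p within \<Omega>. z \<in> \<Omega> \<inter> ball p \<delta>"
        using \<delta> unfolding eventually_at by (auto simp: dist_commute)
      moreover have "\<forall>\<^sub>F z in at p within \<Omega>. F z \<in> ball t r'"
        using tendstoD[OF Ft r'(1)] by eventually_elim (simp add: dist_commute)
      ultimately show ?thesis
      proof eventually_elim
        case (elim z)
        then have "F z \<in> S" using pos by (simp add: S_def)
        then show ?case using \<xi>q[of "F z"] \<Psi>F[OF elim(1)] by (simp add: q_def)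
      qed
    qed
    ultimately show "(\<psi> \<longlongrightarrow> \<xi> t) (at p within \<Omega>)"
      by (rule Lim_transform_eventually)
    show "(\<phi> \<longlongrightarrow> p) (at (\<xi> t) within ball 0 1)"
    proof (rule tendstoI)
      fix e :: real assume e: "e > 0"
      define s where "s = min r' (e / 2)"
      have s: "s > 0" using r' e by (simp add: s_def)
      have "open (\<xi> ` ball t s)"
        by (rule open_mapping_thm[OF hol\<xi> open_ball connected_ball open_ball _ nc]) (auto simp: s_def)
      moreover have "\<xi> t \<in> \<xi> ` ball t s" using s by simp
      ultimately have "\<forall>\<^sub>F w in at (\<xi> t) within ball 0 1. w \<in> \<xi> ` ball t s \<and> w \<in> ball 0 1"
        unfolding eventually_at_topological by blast
      then show "\<forall>\<^sub>F w in at (\<xi> t) within ball 0 1. dist (\<phi> w) p < e"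
      proof eventually_elim
        case (elim w)
        then obtain v where v: "v \<in> ball t s" "w = \<xi> v" by blast
        then have "v \<in> ball t r'" by (simp add: s_def)
        with \<xi>_ge[of v] v elim have vS: "v \<in> S" by (fastforce simp: S_def)
        have "\<phi> w = \<Psi> v"
          using \<xi>q[OF vS] \<psi>[of "\<Psi> v"] \<Psi>S[OF vS] v by (simp add: q_def)
        moreover have "2 * norm (v - t) < e"
          using v by (simp add: s_def dist_norm norm_minus_commute)
        ultimately show ?case using \<Psi>S[OF vS] by (simp add: dist_norm)
      qed
    qed
  qed
qed

section \<open>The conformal map from the half-plane\<close>

text \<open>A cluster value \<open>b\<close> of \<open>\<psi>\<close> along an unbounded sequence is
  sent to infinity. Each frontier point then has a finite real parameter \<open>\<tau> p\<close>,
  depending continuously on \<open>p\<close>; the substance is that \<open>\<tau>\<close> reaches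
  every real number.\<close>

lemma conformal_map_from_half_plane:
  assumes op: "open \<Omega>" and unb: "\<not> bounded \<Omega>" and conn: "connected (frontier \<Omega>)" and q: "q \<notin> closure \<Omega>"
    and hol\<psi>: "\<psi> holomorphic_on \<Omega>" and hol\<phi>: "\<phi> holomorphic_on ball 0 1"
    and \<psi>: "\<And>z. z \<in> \<Omega> \<Longrightarrow> norm (\<psi> z) < 1 \<and> \<phi> (\<psi> z) = z"
    and \<phi>: "\<And>w. norm w < 1 \<Longrightarrow> \<phi> w \<in> \<Omega> \<and> \<psi> (\<phi> w) = w"
    and corr: "\<And>p. p \<in> frontier \<Omega> \<Longrightarrow> \<exists>\<zeta>. norm \<zeta> = 1 \<and> (\<psi> \<longlongrightarrow> \<zeta>) (at p within \<Omega>) \<and>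
      (\<phi> \<longlongrightarrow> p) (at \<zeta> within ball 0 1)"
  obtains \<Phi> where "\<Phi> holomorphic_on {w. Im w > 0}" "inj_on \<Phi> {w. Im w > 0}" "\<Phi> ` {w. Im w > 0} = \<Omega>"
    "\<And>x. Im x = 0 \<Longrightarrow> \<exists>p\<in>frontier \<Omega>. (\<Phi> \<longlongrightarrow> p) (at x within {w. Im w > 0})"
proof -
  let ?H = "{w. Im w > 0}"
  have "\<exists>z\<in>\<Omega>. norm z > real n" for n :: nat
    using unb unfolding bounded_iff by (meson not_le)
  then obtain z where z: "\<And>n. z n \<in> \<Omega>" "\<And>n :: nat. norm (z n) > real n"
    by metis
  have "\<forall>n. (\<psi> \<circ> z) n \<in> cball 0 1"
    using \<psi> z(1) by (auto intro: less_imp_le)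
  then obtain b s where b: "b \<in> cball 0 1" "strict_mono (s :: nat \<Rightarrow> nat)" "((\<psi> \<circ> z) \<circ> s) \<longlonglongrightarrow> b"
    using compact_cball[of "0::complex" 1] unfolding compact_def by meson
  have no_lim: "\<not> (\<lambda>n. z (s n)) \<longlonglongrightarrow> l" for l
  proof
    assume "(\<lambda>n. z (s n)) \<longlonglongrightarrow> l"
    then have "Bseq (\<lambda>n. z (s n))"
      by (intro convergent_imp_Bseq convergentI)
    then obtain B where B: "\<And>n. norm (z (s n)) \<le> B"
      by (auto simp: Bseq_def)
    obtain n where "B < real n" using reals_Archimedean2 by blast
    also have "real n \<le> real (s n)" using b(2) seq_suble by auto
    also have "\<dots> < norm (z (s n))" by (rule z)
    finally show False using B[of n] by simp
  qed
  have zs: "\<phi> (((\<psi> \<circ> z) \<circ> s) n) = z (s n)" for n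
    using \<psi> z(1) by simp
  have b1: "norm b = 1"
  proof (rule ccontr)
    assume "norm b \<noteq> 1"
    then have "b \<in> ball 0 1" using b(1) by simp
    then have "isCont \<phi> b"
      using holomorphic_on_imp_continuous_on[OF hol\<phi>] continuous_on_eq_continuous_at[OF open_ball] by blast
    then have "(\<lambda>n. \<phi> (((\<psi> \<circ> z) \<circ> s) n)) \<longlonglongrightarrow> \<phi> b"
      using b(3) by (rule isCont_tendsto_compose)
    then show False using no_lim unfolding zs by blast
  qed
  \<comment> \<open>At a \<open>\<zeta>\<close> belonging to a frontier point \<open>\<phi>\<close>
    has a finite limit, whereas along the sequence tending to \<open>b\<close> its values
    \<open>z (s n)\<close> are unbounded.\<close>
  have b_ne: "b \<noteq> \<zeta>" if "(\<phi> \<longlongrightarrow> p) (at \<zeta> within ball 0 1)" "norm \<zeta> = 1" for \<zeta> p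
  proof
    assume "b = \<zeta>"
    moreover have lt: "norm (((\<psi> \<circ> z) \<circ> s) n) < 1" for n
      using \<psi> z(1) by simp
    have "((\<psi> \<circ> z) \<circ> s) n \<in> ball 0 1 \<and> ((\<psi> \<circ> z) \<circ> s) n \<noteq> \<zeta>" for n
      using lt[of n] that(2) by (metis less_irrefl mem_ball_0)
    ultimately have "filterlim ((\<psi> \<circ> z) \<circ> s) (at \<zeta> within ball 0 1) sequentially"
      unfolding filterlim_at using b(3) by (blast intro: always_eventually)
    with that(1) have "(\<lambda>n. \<phi> (((\<psi> \<circ> z) \<circ> s) n)) \<longlonglongrightarrow> p"
      by (rule filterlim_compose)
    then show False using no_lim unfolding zs by blast
  qed
  have b0: "b \<noteq> 0" using b1 by auto
  \<comment> \<open>The Cayley map of the disc with pole at \<open>b\<close>; \<open>C'\<close>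
    below is its inverse.\<close>
  define C where "C v = \<i> * (b + v) / (b - v)" for v
  define C' where "C' w = b * (w - \<i>) / (w + \<i>)" for w
  have Im_C: "Im (C v) = (1 - (norm v)\<^sup>2) / (norm (1 - v / b))\<^sup>2" for v
  proof -
    have "C v = \<i> * (1 + v / b) / (1 - v / b)"
    proof (cases "v = b")
      case False
      then show ?thesis using b0 unfolding C_def by (simp add: field_simps)
    qed (simp add: C_def b0)
    then show ?thesis by (simp add: Im_Cayley norm_divide b1)
  qed
  have C_pos: "Im (C v) > 0" if "norm v < 1" for v
  proof -
    have "1 - v / b \<noteq> 0" using that b1 b0 by auto
    then show ?thesis unfolding Im_C using that by (simp add: power_less_one_iff)
  qed
  have wi: "w + \<i> \<noteq> 0" if "Im w \<ge> 0" for w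
  proof -
    have "Im (w + \<i>) > 0" using that by simp
    then show ?thesis by force
  qed
  have C'_less: "norm (C' w) < 1" if "Im w > 0" for w
    using norm_diff_less_norm_diff_cnj[of w \<i>] that wi[of w] b1
    by (simp add: C'_def norm_mult norm_divide divide_less_eq)
  have CC': "C (C' w) = w" if "Im w \<ge> 0" for w
  proof -
    have "b + C' w = 2 * b * w / (w + \<i>)" "b - C' w = 2 * b * \<i> / (w + \<i>)"
      using wi[OF that] by (simp_all add: C'_def field_simps)
    then show ?thesis using wi[OF that] b0 by (simp add: C_def)
  qed
  have C'C: "C' (C v) = v" if "v \<noteq> b" for v
  proof -
    have "C v - \<i> = 2 * \<i> * v / (b - v)" "C v + \<i> = 2 * \<i> * b / (b - v)"
      using that by (simp_all add: C_def field_simps)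
    then show ?thesis using that b0 by (simp add: C'_def)
  qed
  have \<psi>b: "\<psi> z \<noteq> b" if "z \<in> \<Omega>" for z
    using \<psi>[OF that] b1 by auto
  define \<psi>2 where "\<psi>2 z = C (\<psi> z)" for z
  define \<Phi> where "\<Phi> w = \<phi> (C' w)" for w
  have \<psi>\<Phi>: "\<psi>2 (\<Phi> w) = w" and \<Phi>\<Omega>: "\<Phi> w \<in> \<Omega>" if "Im w > 0" for w
    using \<phi>[OF C'_less[OF that]] CC'[of w] that by (auto simp: \<psi>2_def \<Phi>_def)
  have \<Phi>\<psi>: "\<Phi> (\<psi>2 z) = z" and \<psi>_pos: "Im (\<psi>2 z) > 0" if "z \<in> \<Omega>" for z
    using \<psi>[OF that] C_pos[of "\<psi> z"] C'C[OF \<psi>b[OF that]] by (auto simp: \<psi>2_def \<Phi>_def)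
  have hol\<Phi>: "\<Phi> holomorphic_on ?H"
    unfolding \<Phi>_def
  proof (rule holomorphic_on_compose_gen[OF _ hol\<phi>, unfolded o_def])
    show "C' holomorphic_on ?H"
      unfolding C'_def by (intro holomorphic_intros) (use wi in auto)
  qed (use C'_less in auto)
  have hol\<psi>2: "\<psi>2 holomorphic_on \<Omega>"
    unfolding \<psi>2_def C_def using \<psi>b by (intro holomorphic_intros hol\<psi>) (metis right_minus_eq)
  have "\<exists>t. Im t = 0 \<and> (\<psi>2 \<longlongrightarrow> t) (at p within \<Omega>) \<and> (\<Phi> \<longlongrightarrow> p) (at t within ?H)"
    if p: "p \<in> frontier \<Omega>" for p
  proof -
    obtain \<zeta> where \<zeta>: "norm \<zeta> = 1" "(\<psi> \<longlongrightarrow> \<zeta>) (at p within \<Omega>)" "(\<phi> \<longlongrightarrow> p) (at \<zeta> within ball 0 1)"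
      using corr[OF p] by blast
    have "\<zeta> \<noteq> b" using b_ne[OF \<zeta>(3,1)] by blast
    have t: "Im (C \<zeta>) = 0" using \<zeta>(1) by (simp add: Im_C)
    have "(\<psi>2 \<longlongrightarrow> C \<zeta>) (at p within \<Omega>)"
      unfolding \<psi>2_def C_def using \<open>\<zeta> \<noteq> b\<close> by (intro tendsto_intros \<zeta>) auto
    moreover have "(\<Phi> \<longlongrightarrow> p) (at (C \<zeta>) within ?H)"
    proof -
      have "(C' \<longlongrightarrow> C' (C \<zeta>)) (at (C \<zeta>) within ?H)"
        unfolding C'_def by (intro tendsto_intros) (use wi t in auto)
      moreover have "\<forall>\<^sub>F w in at (C \<zeta>) within ?H. w \<in> ?H"
        by (auto simp: eventually_at_topological)
      then have "\<forall>\<^sub>F w in at (C \<zeta>) within ?H. C' w \<in> ball 0 1 \<and> C' w \<noteq> \<zeta>"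
        by eventually_elim (use C'_less \<zeta>(1) in force)
      ultimately have "filterlim C' (at \<zeta> within ball 0 1) (at (C \<zeta>) within ?H)"
        unfolding C'C[OF \<open>\<zeta> \<noteq> b\<close>] filterlim_at by blast
      then show ?thesis
        unfolding \<Phi>_def using filterlim_compose[OF \<zeta>(3)] by blast
    qed
    ultimately show ?thesis using t by blast
  qed
  then obtain \<tau> where \<tau>: "\<And>p. p \<in> frontier \<Omega> \<Longrightarrow> Im (\<tau> p) = 0"
    "\<And>p. p \<in> frontier \<Omega> \<Longrightarrow> (\<psi>2 \<longlongrightarrow> \<tau> p) (at p within \<Omega>)"
    "\<And>p. p \<in> frontier \<Omega> \<Longrightarrow> (\<Phi> \<longlongrightarrow> p) (at (\<tau> p) within ?H)"
    by metis
  have "continuous_on (frontier \<Omega>) \<tau>"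
  proof (rule continuous_on_limit_extension[where X = \<Omega>, OF \<tau>(2)])
    show "frontier \<Omega> \<subseteq> closure \<Omega>" by (simp add: frontier_def)
    show "\<tau> x = \<psi>2 x" if "x \<in> \<Omega>" "x \<in> frontier \<Omega>" for x
      using that op by (simp add: frontier_def interior_open)
  qed
  then have connJ: "connected ((\<lambda>p. Re (\<tau> p)) ` frontier \<Omega>)"
    using conn by (intro connected_continuous_image continuous_intros)
  \<comment> \<open>That is, \<open>\<Phi>\<close> tends to infinity at \<open>y\<close>. Otherwise
    its values cluster at a finite \<open>l\<close>: if \<open>l\<close> lies in
    \<open>\<Omega>\<close>, then \<open>y = \<psi>2 l\<close> would have positive imaginary part;
    if on the frontier, then \<open>y = \<tau> l\<close>.\<close>
  have inv_lim: "((\<lambda>w. inverse (\<Phi> w - q)) \<longlongrightarrow> 0) (at y within ?H)"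
    if y: "Im y = 0" "y \<notin> \<tau> ` frontier \<Omega>" for y
  proof (rule tendstoI, rule ccontr)
    fix e :: real assume e: "e > 0"
    assume "\<not> (\<forall>\<^sub>F w in at y within ?H. dist (inverse (\<Phi> w - q)) 0 < e)"
    then have "\<exists>w\<in>?H. w \<noteq> y \<and> dist w y < inverse (Suc n) \<and> \<not> dist (inverse (\<Phi> w - q)) 0 < e" for n
      unfolding eventually_at by (metis inverse_positive_iff_positive of_nat_0_less_iff zero_less_Suc)
    then obtain w where w: "\<And>n. w n \<in> ?H" "\<And>n. dist (w n) y < inverse (Suc n)"
      "\<And>n. \<not> dist (inverse (\<Phi> (w n) - q)) 0 < e"
      by metis
    have wy: "w \<longlonglongrightarrow> y"
    proof (rule metric_LIMSEQ_I)
      fix r :: real assume "r > 0"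
      then obtain N where N: "inverse (Suc N) < r" using reals_Archimedean by blast
      have "dist (w n) y < r" if "n \<ge> N" for n
      proof -
        have "inverse (real (Suc n)) \<le> inverse (real (Suc N))"
          using that by (intro le_imp_inverse_le) auto
        then show ?thesis using w(2)[of n] N by linarith
      qed
      then show "\<exists>N. \<forall>n\<ge>N. dist (w n) y < r" by blast
    qed
    have "(\<Phi> \<circ> w) n \<in> cball q (inverse e)" for n
    proof -
      have "\<Phi> (w n) \<noteq> q" using \<Phi>\<Omega> w(1) q closure_subset by blast
      moreover have "e \<le> inverse (norm (\<Phi> (w n) - q))"
        using w(3)[of n] unfolding dist_norm diff_0_right norm_inverse not_less .
      ultimately have "norm (\<Phi> (w n) - q) \<le> inverse e"
        using e le_imp_inverse_le by fastforce
      then show ?thesis by (simp add: dist_norm norm_minus_commute)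
    qed
    then obtain l \<sigma> where l: "strict_mono (\<sigma> :: nat \<Rightarrow> nat)" "((\<Phi> \<circ> w) \<circ> \<sigma>) \<longlonglongrightarrow> l"
      using compact_cball[of q "inverse e"] unfolding compact_def by meson
    have w\<sigma>: "(\<lambda>n. w (\<sigma> n)) \<longlonglongrightarrow> y"
      using LIMSEQ_subseq_LIMSEQ[OF wy l(1)] by (simp add: o_def)
    have in\<Omega>: "((\<Phi> \<circ> w) \<circ> \<sigma>) n \<in> \<Omega>" for n using \<Phi>\<Omega> w(1) by simp
    have eq: "\<psi>2 (((\<Phi> \<circ> w) \<circ> \<sigma>) n) = w (\<sigma> n)" for n using \<psi>\<Phi> w(1) by simp
    have lcl: "l \<in> closure \<Omega>"
      unfolding closure_sequential using in\<Omega> l(2) by blast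
    show False
    proof (cases "l \<in> \<Omega>")
      case True
      then have "isCont \<psi>2 l"
        using holomorphic_on_imp_continuous_on[OF hol\<psi>2] continuous_on_eq_continuous_at[OF op] by blast
      then have "(\<lambda>n. \<psi>2 (((\<Phi> \<circ> w) \<circ> \<sigma>) n)) \<longlonglongrightarrow> \<psi>2 l"
        using l(2) by (rule isCont_tendsto_compose)
      then have "y = \<psi>2 l" using LIMSEQ_unique[OF w\<sigma>] unfolding eq by blast
      then show False using \<psi>_pos[OF True] y by simp
    next
      case False
      then have lf: "l \<in> frontier \<Omega>" using lcl op by (simp add: frontier_def interior_open)
      have "filterlim ((\<Phi> \<circ> w) \<circ> \<sigma>) (at l within \<Omega>) sequentially"
        unfolding filterlim_at using l(2) in\<Omega> False by (auto intro!: always_eventually)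
      then have "(\<lambda>n. \<psi>2 (((\<Phi> \<circ> w) \<circ> \<sigma>) n)) \<longlonglongrightarrow> \<tau> l"
        by (rule filterlim_compose[OF \<tau>(2)[OF lf]])
      then have "y = \<tau> l" using LIMSEQ_unique[OF w\<sigma>] unfolding eq by blast
      then show False using y lf by blast
    qed
  qed
  have surj: "x \<in> \<tau> ` frontier \<Omega>" if x: "Im x = 0" for x
  proof (rule ccontr)
    assume nx: "x \<notin> \<tau> ` frontier \<Omega>"
    let ?J = "(\<lambda>p. Re (\<tau> p)) ` frontier \<Omega>"
    have xJ: "Re x \<notin> ?J"
    proof
      assume "Re x \<in> ?J"
      then obtain p where p: "p \<in> frontier \<Omega>" "Re x = Re (\<tau> p)" by blast
      then have "x = \<tau> p" using x \<tau>(1) by (simp add: complex_eq_iff)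
      then show False using nx p by blast
    qed
    \<comment> \<open>A connected set of reals missing \<open>Re x\<close> lies on one side of it,
      so an interval of length 2 on the other side is free.\<close>
    have "\<exists>c. \<forall>y. \<bar>y - c\<bar> < 1 \<longrightarrow> y \<notin> ?J"
    proof (cases "\<exists>j\<in>?J. j < Re x")
      case True
      then obtain j where j: "j \<in> ?J" "j < Re x" by blast
      have "y \<notin> ?J" if "\<bar>y - (Re x + 1)\<bar> < 1" for y
      proof
        assume "y \<in> ?J"
        then have "Re x \<in> ?J"
          using connJ[unfolded connected_iff_interval, rule_format, OF j(1), of y "Re x"] j(2) that by auto
        then show False using xJ by blast
      qed
      then show ?thesis by blast
    next
      case False
      then have "y \<notin> ?J" if "\<bar>y - (Re x - 1)\<bar> < 1" for y using that by force
      then show ?thesis by blast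
    qed
    then obtain c where c: "\<And>y. \<bar>y - c\<bar> < 1 \<Longrightarrow> y \<notin> ?J" by blast
    let ?B = "ball (of_real c) 1 :: complex set"
    \<comment> \<open>Extended by 0 below the real line, \<open>1 / (\<Phi> - q)\<close> is
      continuous across the free interval, hence holomorphic there; vanishing below, it would vanish
      above as well.\<close>
    define k where "k w = (if Im w > 0 then inverse (\<Phi> w - q) else 0)" for w
    have nz: "\<Phi> w - q \<noteq> 0" if "Im w > 0" for w
      using \<Phi>\<Omega>[OF that] q closure_subset by auto
    have k1: "k holomorphic_on {w. Im w > 0}"
    proof (rule holomorphic_transform)
      show "(\<lambda>w. inverse (\<Phi> w - q)) holomorphic_on ?H"
        using nz by (intro holomorphic_intros hol\<Phi>) auto
    qed (simp add: k_def)
    have k2: "k holomorphic_on {w. Im w < 0}"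
      by (rule holomorphic_transform[where f = "\<lambda>_. 0"]) (auto simp: k_def)
    have contk: "continuous_on ?B k"
    proof (rule continuous_at_imp_continuous_on, rule ballI)
      fix w assume w: "w \<in> ?B"
      consider "Im w > 0" | "Im w < 0" | "Im w = 0" by linarith
      then show "isCont k w"
      proof cases
        case 1
        then show ?thesis
          using holomorphic_on_imp_continuous_on[OF k1] continuous_on_eq_continuous_at[OF open_halfspace_Im_gt]
          by blast
      next
        case 2
        then show ?thesis
          using holomorphic_on_imp_continuous_on[OF k2] continuous_on_eq_continuous_at[OF open_halfspace_Im_lt]
          by blast
      next
        case 3
        have "\<bar>Re w - c\<bar> < 1"
          using w abs_Re_le_cmod[of "w - of_real c"] by (simp add: dist_norm norm_minus_commute)
        then have nw: "w \<notin> \<tau> ` frontier \<Omega>" using c by auto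
        have "(k \<longlongrightarrow> 0) (at w)"
        proof (rule tendstoI)
          fix e :: real assume e: "e > 0"
          obtain d where "d > 0" "\<And>v. Im v > 0 \<Longrightarrow> v \<noteq> w \<Longrightarrow> dist v w < d \<Longrightarrow> dist (inverse (\<Phi> v - q)) 0 < e"
            using tendstoD[OF inv_lim[OF 3 nw] e] by (auto simp: eventually_at)
          then show "\<forall>\<^sub>F v in at w. dist (k v) 0 < e"
            unfolding eventually_at using e by (auto simp: k_def intro!: exI[of _ d])
        qed
        then show ?thesis using 3 by (simp add: isCont_def k_def)
      qed
    qed
    have hk: "k holomorphic_on ?B"
    proof (rule holomorphic_on_paste_across_line[where d = \<i> and k = 0])
      show "k holomorphic_on ?B \<inter> {z. inner \<i> z < 0}"
        by (rule holomorphic_on_subset[OF k2]) (auto simp: inner_complex_def)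
      show "k holomorphic_on ?B \<inter> {z. 0 < inner \<i> z}"
        by (rule holomorphic_on_subset[OF k1]) (auto simp: inner_complex_def)
    qed (use contk in auto)
    define v where "v = of_real c + \<i> / 2"
    have v: "v \<in> ?B" "Im v > 0" by (auto simp: v_def dist_norm norm_divide)
    have "k v = 0"
    proof (rule analytic_continuation_open[where s = "?B \<inter> {w. Im w < 0}" and s' = ?B and f = k and g = "\<lambda>_. 0"])
      show "open (?B \<inter> {w. Im w < 0})" by (intro open_Int open_ball open_halfspace_Im_lt)
      have "of_real c - \<i> / 2 \<in> ?B \<inter> {w. Im w < 0}" by (auto simp: dist_norm norm_divide)
      then show "?B \<inter> {w. Im w < 0} \<noteq> {}" by blast
    qed (use hk v in \<open>auto simp: k_def\<close>)
    then show False using nz[OF v(2)] v(2) by (simp add: k_def)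
  qed
  show ?thesis
  proof
    show "\<Phi> holomorphic_on ?H" by (rule hol\<Phi>)
    show "inj_on \<Phi> ?H" by (rule inj_on_inverseI[where g = \<psi>2]) (use \<psi>\<Phi> in auto)
    show "\<Phi> ` ?H = \<Omega>" using \<Phi>\<Omega> \<Phi>\<psi> \<psi>_pos by (force simp: image_iff)
    show "\<exists>p\<in>frontier \<Omega>. (\<Phi> \<longlongrightarrow> p) (at x within ?H)" if "Im x = 0" for x
      using surj[OF that] \<tau>(3) by blast
  qed
qed

section \<open>Harnack inequality and gradient bound\<close>

text \<open>In the squared Schwarz--Pick inequality the real parts enter as
  \<open>(Re (f w) - Re (f z))\<^sup>2\<close> on the left and \<open>s\<^sup>2\<close> times that
  on the right. As \<open>s < 1\<close> they can be discarded, leaving the inequality between the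
  imaginary parts.\<close>

lemma Harnack_ball_Im:
  assumes holf: "f holomorphic_on ball z d"
    and pos: "\<And>w. w \<in> ball z d \<Longrightarrow> Im (f w) > 0" and w: "w \<in> ball z d" and s: "norm (w - z) = s * d"
  shows "Im (f z) * (1 - s) \<le> Im (f w) * (1 + s)"
proof (rule ccontr)
  assume "\<not> ?thesis"
  then have *: "s * (Im (f w) + Im (f z)) < Im (f z) - Im (f w)"
    by (simp add: algebra_simps)
  have d: "d > 0" using w by (metis ball_eq_empty empty_iff not_le)
  have s0: "0 \<le> s" using s d by (metis norm_ge_zero zero_le_mult_iff not_le)
  have "s * d < 1 * d" using w s by (simp add: dist_norm norm_minus_commute)
  then have s1: "s < 1" using d by simp
  have "d * norm (f w - f z) \<le> s * d * norm (f w - cnj (f z))"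
    using Schwarz_Pick_ball_half_plane[OF holf pos w] s by simp
  then have "norm (f w - f z) \<le> s * norm (f w - cnj (f z))"
    using d by (simp add: mult.assoc mult.left_commute)
  then have "(norm (f w - f z))\<^sup>2 \<le> (s * norm (f w - cnj (f z)))\<^sup>2"
    by (intro power_mono) auto
  then have "(Re (f w) - Re (f z))\<^sup>2 + (Im (f w) - Im (f z))\<^sup>2
      \<le> s\<^sup>2 * (Re (f w) - Re (f z))\<^sup>2 + (s * (Im (f w) + Im (f z)))\<^sup>2"
    unfolding power_mult_distrib cmod_power2 by (simp add: algebra_simps)
  moreover have "s\<^sup>2 * (Re (f w) - Re (f z))\<^sup>2 \<le> 1 * (Re (f w) - Re (f z))\<^sup>2"
    using s0 s1 by (intro mult_right_mono) (auto simp: power_le_one)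
  moreover have "(s * (Im (f w) + Im (f z)))\<^sup>2 < (Im (f z) - Im (f w))\<^sup>2"
    using * s0 pos[OF w] pos[of z] d by (intro power_strict_mono) auto
  moreover have "(Im (f z) - Im (f w))\<^sup>2 = (Im (f w) - Im (f z))\<^sup>2"
    by (rule power2_commute)
  ultimately show False by linarith
qed

text \<open>At the boundary point \<open>p\<close> nearest to \<open>z\<close>, at distance \<open>d\<close>, the condition \<open>\<bar>f\<bar> \<rightarrow> 1\<close> bounds
  \<open>Im F\<close> on the radius towards \<open>p\<close> by twice the distance to \<open>p\<close>; by Harnack, \<open>Im F z \<le> 4 d\<close>.\<close>

lemma gradient_bound:
  assumes op: "open \<Omega>" and F: "\<And>z. z \<in> \<Omega> \<Longrightarrow> (F has_field_derivative f z) (at z)"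
    and pos: "\<And>z. z \<in> \<Omega> \<Longrightarrow> Im (F z) > 0" and fr: "frontier \<Omega> \<noteq> {}"
    and bd: "\<And>q. q \<in> frontier \<Omega> \<Longrightarrow> ((\<lambda>z. Im (F z)) \<longlongrightarrow> 0) (at q within \<Omega>)"
    and bdf: "\<And>q. q \<in> frontier \<Omega> \<Longrightarrow> ((\<lambda>z. norm (f z)) \<longlongrightarrow> 1) (at q within \<Omega>)"
    and z: "z \<in> \<Omega>"
  shows "norm (f z) \<le> 8"
proof -
  obtain p where p: "p \<in> frontier \<Omega>" "\<And>y. y \<in> frontier \<Omega> \<Longrightarrow> dist z p \<le> dist z y"
    using distance_attains_inf[OF frontier_closed fr, of z] by blast
  define d where "d = dist z p"
  have pn: "p \<notin> \<Omega>" using p op by (simp add: frontier_def interior_open)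
  then have d: "d > 0" using z by (auto simp: d_def)
  have ball: "ball z d \<subseteq> \<Omega>"
  proof (rule ccontr)
    assume "\<not> ball z d \<subseteq> \<Omega>"
    moreover have "z \<in> ball z d \<inter> \<Omega>" using z d by simp
    ultimately have "ball z d \<inter> frontier \<Omega> \<noteq> {}"
      by (intro connected_Int_frontier connected_ball) blast+
    then show False using p(2) by (force simp: d_def)
  qed
  have holF: "F holomorphic_on ball z d"
    using F ball by (meson holomorphic_on_open open_ball subsetD)
  have posF: "Im (F w) > 0" if "w \<in> ball z d" for w using pos ball that by blast
  obtain \<delta> where \<delta>: "\<delta> > 0" "\<And>y. y \<in> \<Omega> \<Longrightarrow> dist y p < \<delta> \<Longrightarrow> norm (f y) \<le> 2"
  proof -
    have "\<forall>\<^sub>F y in at p within \<Omega>. norm (f y) < 2"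
      using bdf[OF p(1)] by (rule order_tendstoD) simp
    then obtain \<delta> where "\<delta> > 0" "\<And>y. y \<in> \<Omega> \<Longrightarrow> y \<noteq> p \<Longrightarrow> dist y p < \<delta> \<Longrightarrow> norm (f y) < 2"
      by (auto simp: eventually_at)
    then show ?thesis using that[of \<delta>] pn by (metis less_imp_le)
  qed
  define \<zeta> where "\<zeta> s = z + of_real s * (p - z)" for s
  have d_norm: "norm (p - z) = d" by (simp add: d_def dist_norm norm_minus_commute)
  have \<zeta>z: "norm (\<zeta> s - z) = s * d" if "0 \<le> s" for s
    using that by (simp add: \<zeta>_def norm_mult d_norm)
  have \<zeta>\<zeta>: "norm (\<zeta> s - \<zeta> s') = \<bar>s - s'\<bar> * d" for s s'
  proof -
    have "\<zeta> s - \<zeta> s' = of_real (s - s') * (p - z)" by (simp add: \<zeta>_def algebra_simps)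
    then show ?thesis by (simp only: norm_mult norm_of_real d_norm)
  qed
  have \<zeta>1: "\<zeta> 1 = p" by (simp add: \<zeta>_def)
  have \<zeta>p: "dist (\<zeta> s) p = \<bar>s - 1\<bar> * d" for s
    using \<zeta>\<zeta>[of s 1] by (simp add: dist_norm \<zeta>1)
  have \<zeta>ball: "\<zeta> s \<in> ball z d" if "0 \<le> s" "s < 1" for s
    using \<zeta>z[OF that(1)] that d by (simp add: dist_norm norm_minus_commute)
  \<comment> \<open>From parameter \<open>s\<close> on, the radius lies within
    \<open>\<delta> / 2\<close> of \<open>p\<close>, where \<open>norm (f y) \<le> 2\<close>; the
    maximum with 0 covers \<open>\<delta> \<ge> 2 * d\<close>.\<close>
  define s where "s = max 0 (1 - \<delta> / (2 * d))"
  have s: "0 \<le> s" "s < 1" "(1 - s) * d < \<delta>"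
  proof -
    have "(1 - s) * d \<le> (\<delta> / (2 * d)) * d"
      using d by (intro mult_right_mono) (auto simp: s_def)
    also have "\<dots> < \<delta>" using d \<delta> by simp
    finally show "(1 - s) * d < \<delta>" .
  qed (use \<delta> d in \<open>auto simp: s_def\<close>)
  \<comment> \<open>The intersection of the two balls is convex and lies in \<open>\<Omega>\<close>,
    so the mean value inequality applies with constant 2. Letting \<open>s'\<close> tend to 1 brings
    in the boundary value 0.\<close>
  have step: "Im (F (\<zeta> s)) \<le> Im (F (\<zeta> s')) + 2 * ((s' - s) * d)" if s': "s \<le> s'" "s' < 1" for s'
  proof -
    have in_W: "\<zeta> y \<in> ball z d \<inter> ball p \<delta>" if y: "s \<le> y" "y < 1" for y
    proof -
      have "\<bar>y - 1\<bar> * d \<le> (1 - s) * d" using y d by (intro mult_right_mono) auto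
      then show ?thesis using \<zeta>ball[of y] \<zeta>p[of y] y s by (simp add: dist_commute)
    qed
    have "norm (F (\<zeta> s) - F (\<zeta> s')) \<le> 2 * norm (\<zeta> s - \<zeta> s')"
    proof (rule field_differentiable_bound[where S = "ball z d \<inter> ball p \<delta>" and f' = f])
      show "convex (ball z d \<inter> ball p \<delta>)" by (intro convex_Int convex_ball)
      show "(F has_field_derivative f y) (at y within ball z d \<inter> ball p \<delta>)" if "y \<in> ball z d \<inter> ball p \<delta>" for y
        using F ball that by (blast intro: DERIV_subset)
      show "norm (f y) \<le> 2" if "y \<in> ball z d \<inter> ball p \<delta>" for y
        using \<delta>(2)[of y] subsetD[OF ball, of y] that by (simp add: dist_commute)
    qed (use in_W s s' in auto)
    also have "\<dots> = 2 * ((s' - s) * d)" unfolding \<zeta>\<zeta> using s' by simp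
    finally show ?thesis
      using abs_Im_le_cmod[of "F (\<zeta> s) - F (\<zeta> s')"] by simp
  qed
  have "Im (F (\<zeta> s)) \<le> 0 + 2 * ((1 - s) * d)"
  proof (rule tendsto_lowerbound)
    have "(\<zeta> \<longlongrightarrow> p) (at_left 1)"
      unfolding \<zeta>_def by (auto intro!: tendsto_eq_intros)
    moreover have ev: "\<forall>\<^sub>F s' in at_left 1. s < s' \<and> s' < 1"
      using eventually_at_left_real[OF s(2)] by eventually_elim simp
    then have "\<forall>\<^sub>F s' in at_left 1. \<zeta> s' \<in> \<Omega> \<and> \<zeta> s' \<noteq> p"
    proof eventually_elim
      case (elim s')
      then have "\<zeta> s' \<in> \<Omega>" using subsetD[OF ball \<zeta>ball[of s']] s(1) by simp
      then show ?case using pn by metis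
    qed
    ultimately have "filterlim \<zeta> (at p within \<Omega>) (at_left 1)"
      unfolding filterlim_at by blast
    then have "((\<lambda>s'. Im (F (\<zeta> s'))) \<longlongrightarrow> 0) (at_left 1)"
      by (rule filterlim_compose[OF bd[OF p(1)]])
    then show "((\<lambda>s'. Im (F (\<zeta> s')) + 2 * ((s' - s) * d)) \<longlongrightarrow> 0 + 2 * ((1 - s) * d)) (at_left 1)"
      by (intro tendsto_intros)
    show "\<forall>\<^sub>F s' in at_left 1. Im (F (\<zeta> s)) \<le> Im (F (\<zeta> s')) + 2 * ((s' - s) * d)"
      using ev by eventually_elim (use step in auto)
  qed simp
  \<comment> \<open>Harnack loses a factor \<open>1 - s\<close> towards the boundary; the linear
    decay of \<open>Im F\<close> at \<open>p\<close> contains the same factor, so it cancels and the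
    bound \<open>4 * d\<close> depends on neither \<open>s\<close> nor
    \<open>\<delta>\<close>.\<close>
  moreover have "Im (F z) * (1 - s) \<le> Im (F (\<zeta> s)) * (1 + s)"
    by (rule Harnack_ball_Im[OF holF posF \<zeta>ball \<zeta>z]) (use s in auto)
  moreover have "Im (F (\<zeta> s)) * (1 + s) \<le> (2 * ((1 - s) * d)) * 2"
    using calculation(1) s d posF[OF \<zeta>ball[OF s(1,2)]] by (intro mult_mono) auto
  ultimately have "Im (F z) * (1 - s) \<le> (2 * ((1 - s) * d)) * 2" by linarith
  also have "\<dots> = (4 * d) * (1 - s)" by simp
  finally have "Im (F z) * (1 - s) \<le> (4 * d) * (1 - s)" .
  then have le: "Im (F z) \<le> 4 * d" using s by simp
  have "norm (deriv F z) \<le> 2 * Im (F z) / d"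
    by (rule norm_deriv_le_Im[OF holF d posF])
  also have "\<dots> \<le> 2 * (4 * d) / d"
    using le d by (intro divide_right_mono) auto
  finally show ?thesis using DERIV_imp_deriv[OF F[OF z]] d by simp
qed

section \<open>Rigidity\<close>

text \<open>The inward normal is \<open>\<i> * \<alpha>\<close>, the image of the direction
  \<open>\<i>\<close>.\<close>

lemma affine_image_upper_half_plane:
  assumes \<alpha>: "\<alpha> \<noteq> 0"
  shows "half_plane ((\<lambda>w. \<alpha> * w + \<beta>) ` {w. Im w > 0})"
proof -
  have eq: "inner (\<i> * \<alpha>) (\<alpha> * w + \<beta>) = (norm \<alpha>)\<^sup>2 * Im w + inner (\<i> * \<alpha>) \<beta>" for w
    unfolding cmod_power2 by (simp add: inner_complex_def power2_eq_square algebra_simps)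
  have "(\<lambda>w. \<alpha> * w + \<beta>) ` {w. Im w > 0} = {z. inner (\<i> * \<alpha>) z > inner (\<i> * \<alpha>) \<beta>}"
  proof (intro equalityI subsetI)
    fix z assume z: "z \<in> {z. inner (\<i> * \<alpha>) z > inner (\<i> * \<alpha>) \<beta>}"
    define w where "w = (z - \<beta>) / \<alpha>"
    have zw: "z = \<alpha> * w + \<beta>" using \<alpha> by (simp add: w_def)
    have "(norm \<alpha>)\<^sup>2 * Im w > 0" using z unfolding zw mem_Collect_eq eq by simp
    then have "Im w > 0" using \<alpha> by (simp add: zero_less_mult_iff)
    then show "z \<in> (\<lambda>w. \<alpha> * w + \<beta>) ` {w. Im w > 0}" using zw by blast
  qed (use \<alpha> in \<open>auto simp: eq\<close>)
  then show ?thesis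
    using \<alpha> unfolding half_plane_def by (metis complex_i_not_zero mult_eq_0_iff)
qed

lemma exp_derivative_inj_imp_constant:
  assumes d\<Phi>: "\<And>w. Im w > 0 \<Longrightarrow> (\<Phi> has_field_derivative a * exp (- \<i> * (of_real c * w + d))) (at w)"
    and inj: "inj_on \<Phi> {w. Im w > 0}"
  shows "c = (0::real)"
proof (rule ccontr)
  assume c: "c \<noteq> 0"
  define P where "P w = a * \<i> / of_real c * exp (- \<i> * (of_real c * w + d))" for w
  have dP: "(P has_field_derivative a * exp (- \<i> * (of_real c * w + d))) (at w)" for w
    unfolding P_def using c by (auto intro!: derivative_eq_intros simp: field_simps)
  have "\<exists>k. \<forall>w\<in>{w. Im w > 0}. \<Phi> w - P w = k"
  proof (rule has_field_derivative_zero_constant)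
    show "convex {w. Im w > 0}" by (rule convex_halfspace_Im_gt)
    show "((\<lambda>w. \<Phi> w - P w) has_field_derivative 0) (at w within {w. Im w > 0})"
      if "w \<in> {w. Im w > 0}" for w
    proof -
      have "((\<lambda>w. \<Phi> w - P w) has_field_derivative
          a * exp (- \<i> * (of_real c * w + d)) - a * exp (- \<i> * (of_real c * w + d))) (at w)"
        using that by (intro DERIV_diff d\<Phi> dP) simp
      then show ?thesis
        by (simp add: has_field_derivative_at_within)
    qed
  qed
  then obtain k where k: "\<And>w. Im w > 0 \<Longrightarrow> \<Phi> w - P w = k" by blast
  \<comment> \<open>A translate of \<open>\<i>\<close> by the period \<open>2 * pi / c\<close> of
    \<open>P\<close>. The period is real, so the half-plane is not left, whatever the sign of
    \<open>c\<close>.\<close>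
  define w where "w = \<i> + of_real (2 * pi / c)"
  have "- \<i> * (of_real c * w + d) = - \<i> * (of_real c * \<i> + d) - 2 * of_real pi * \<i>"
    using c by (simp add: w_def field_simps)
  then have "P w = P \<i>"
    unfolding P_def by (simp add: exp_diff exp_two_pi_i)
  then have "\<Phi> w = \<Phi> \<i>" using k[of w] k[of \<i>] by (simp add: w_def algebra_simps)
  moreover have "Im w > 0" by (simp add: w_def)
  ultimately have "w = \<i>" using inj_onD[OF inj, of w \<i>] by simp
  then show False using c by (simp add: w_def)
qed

theorem mainTheorem5:
  fixes \<Omega> :: "complex set" and u :: "complex \<Rightarrow> real"
  assumes "exceptional_domain \<Omega>"
    and "assoc_fun \<Omega> u"
    and "connected (frontier \<Omega>)"
    and "proper_arc (frontier \<Omega>)"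
  shows "(\<forall>z\<in>\<Omega>. norm (grad u z) = 1) \<and> half_plane \<Omega>"
proof -
  let ?H = "{w. Im w > 0}"
  have smooth: "smooth_domain \<Omega>" and con: "connected \<Omega>" and unb: "\<not> bounded \<Omega>" and fr: "frontier \<Omega> \<noteq> {}"
    using assms(1) by (auto simp: exceptional_domain_def)
  then have op: "open \<Omega>" by (simp add: smooth_domain_def)
  have "\<not> bounded (frontier \<Omega>)"
  proof -
    obtain \<gamma> where \<gamma>: "range \<gamma> = frontier \<Omega>" "filterlim (\<lambda>t::real. norm (\<gamma> t :: complex)) at_top at_top"
      using assms(4) by (auto simp: proper_arc_def)
    have "\<exists>z\<in>frontier \<Omega>. \<not> norm z \<le> B" for B
    proof -
      have "\<forall>\<^sub>F t in at_top. norm (\<gamma> t) > B"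
        using \<gamma>(2) by (simp add: filterlim_at_top_dense)
      then obtain t where "norm (\<gamma> t) > B"
        using eventually_happens[of _ "at_top :: real filter"] by auto
      then show ?thesis using \<gamma>(1) by (metis not_le rangeI)
    qed
    then show ?thesis unfolding bounded_iff by blast
  qed
  \<comment> \<open>For an unbounded connected open set, simple connectedness means that all
    components of the frontier are unbounded; here there is only one.\<close>
  moreover have "components (frontier \<Omega>) = {frontier \<Omega>}"
    using assms(3) fr by (simp add: components_eq_sing_iff)
  ultimately have sc: "simply_connected \<Omega>"
    using con unb by (simp add: simply_connected_eq_frontier_properties[OF op])

  \<comment> \<open>The function F and its boundary behaviour\<close>
  have harm: "harmonic_on \<Omega> u" and contu: "continuous_on (closure \<Omega>) u"
    and upos: "\<And>z. z \<in> \<Omega> \<Longrightarrow> u z > 0" and u0: "\<And>z. z \<in> frontier \<Omega> \<Longrightarrow> u z = 0"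
    using assms(2) by (auto simp: assoc_fun_def)
  obtain G where contG: "continuous_on (closure \<Omega>) G" and G: "\<And>z. z \<in> \<Omega> \<Longrightarrow> G z = grad u z"
    and G1: "\<And>z. z \<in> frontier \<Omega> \<Longrightarrow> norm (G z) = 1"
    using assms(2) by (auto simp: assoc_fun_def)
  define f where "f z = \<i> * cnj (grad u z)" for z
  define g where "g z = \<i> * cnj (G z)" for z
  have contg: "continuous_on (closure \<Omega>) g"
    unfolding g_def by (intro continuous_intros contG)
  have gf: "g z = f z" if "z \<in> \<Omega>" for z using G[OF that] by (simp add: g_def f_def)
  have g1: "norm (g z) = 1" if "z \<in> frontier \<Omega>" for z using G1[OF that] by (simp add: g_def norm_mult)
  obtain F where F: "\<And>z. z \<in> \<Omega> \<Longrightarrow> (F has_field_derivative f z) (at z)"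
    and ImF: "\<And>z. z \<in> \<Omega> \<Longrightarrow> Im (F z) = u z"
    using harmonic_on_simply_connected_imp_Im[OF harm sc] unfolding f_def by metis
  have posF: "Im (F z) > 0" if "z \<in> \<Omega>" for z using ImF upos that by simp
  have holF: "F holomorphic_on \<Omega>"
    using F op by (meson holomorphic_on_open)
  have frcl: "frontier \<Omega> \<subseteq> closure \<Omega>" by (simp add: frontier_def)
  have ev_in: "\<forall>\<^sub>F z in at p within \<Omega>. z \<in> \<Omega>" for p
    by (auto simp: eventually_at_topological)
  have bd: "((\<lambda>z. Im (F z)) \<longlongrightarrow> 0) (at p within \<Omega>)" if p: "p \<in> frontier \<Omega>" for p
  proof -
    have "(u \<longlongrightarrow> u p) (at p within closure \<Omega>)"
      using contu p frcl by (auto simp: continuous_on_def)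
    then have "(u \<longlongrightarrow> 0) (at p within \<Omega>)"
      using tendsto_within_subset[OF _ closure_subset] u0[OF p] by metis
    moreover have "\<forall>\<^sub>F z in at p within \<Omega>. u z = Im (F z)"
      using ev_in by eventually_elim (simp add: ImF)
    ultimately show ?thesis by (rule Lim_transform_eventually)
  qed
  have bdf: "((\<lambda>z. norm (f z)) \<longlongrightarrow> 1) (at p within \<Omega>)" if p: "p \<in> frontier \<Omega>" for p
  proof -
    have "(g \<longlongrightarrow> g p) (at p within closure \<Omega>)"
      using contg p frcl by (auto simp: continuous_on_def)
    then have "(g \<longlongrightarrow> g p) (at p within \<Omega>)"
      using tendsto_within_subset[OF _ closure_subset] by metis
    then have "((\<lambda>z. norm (g z)) \<longlongrightarrow> 1) (at p within \<Omega>)"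
      using tendsto_norm g1[OF p] by metis
    moreover have "\<forall>\<^sub>F z in at p within \<Omega>. norm (g z) = norm (f z)"
      using ev_in by eventually_elim (simp add: gf)
    ultimately show ?thesis by (rule Lim_transform_eventually)
  qed

  \<comment> \<open>Uniformization by the upper half-plane\<close>
  have "\<Omega> \<noteq> {}" "\<Omega> \<noteq> UNIV" using fr by auto
  then have "\<exists>\<psi> \<phi>. \<psi> holomorphic_on \<Omega> \<and> \<phi> holomorphic_on ball 0 1 \<and>
      (\<forall>z\<in>\<Omega>. \<psi> z \<in> ball 0 1 \<and> \<phi> (\<psi> z) = z) \<and> (\<forall>w\<in>ball 0 1. \<phi> w \<in> \<Omega> \<and> \<psi> (\<phi> w) = w)"
    using sc simply_connected_eq_biholomorphic_to_disc[OF op] by blast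
  then obtain \<psi> \<phi> where hol: "\<psi> holomorphic_on \<Omega>" "\<phi> holomorphic_on ball 0 1"
    and \<psi>: "\<And>z. z \<in> \<Omega> \<Longrightarrow> norm (\<psi> z) < 1 \<and> \<phi> (\<psi> z) = z"
    and \<phi>: "\<And>w. norm w < 1 \<Longrightarrow> \<phi> w \<in> \<Omega> \<and> \<psi> (\<phi> w) = w"
    by (metis mem_ball_0)
  have corr: "\<exists>\<zeta>. norm \<zeta> = 1 \<and> (\<psi> \<longlongrightarrow> \<zeta>) (at p within \<Omega>) \<and> (\<phi> \<longlongrightarrow> p) (at \<zeta> within ball 0 1)"
    if p: "p \<in> frontier \<Omega>" for p
  proof -
    \<comment> \<open>Against \<open>norm (g p) = 1\<close>, the error 1/2 leaves Lipschitz
      constants 1/2 and 3/2, which gives both bounds with factor 2.\<close>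
    obtain \<rho> where \<rho>: "\<rho> > 0" "\<And>y z. y \<in> \<Omega> \<inter> ball p \<rho> \<Longrightarrow> z \<in> \<Omega> \<inter> ball p \<rho> \<Longrightarrow>
        norm (F y - F z - g p * (y - z)) \<le> 1 / 2 * norm (y - z)"
      using smooth_domain_boundary_linearization[OF smooth p F contg gf, of "1 / 2"] by auto
    have gp: "norm (g p * (y - z)) = norm (y - z)" for y z using g1[OF p] by (simp add: norm_mult)
    have lower: "norm (y - z) \<le> 2 * norm (F y - F z)" and upper: "norm (F y - F z) \<le> 2 * norm (y - z)"
      if "y \<in> \<Omega> \<inter> ball p \<rho>" "z \<in> \<Omega> \<inter> ball p \<rho>" for y z
    proof -
      have "norm (g p * (y - z)) - norm (F y - F z) \<le> norm (F y - F z - g p * (y - z))"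
        by (metis norm_minus_commute norm_triangle_ineq2)
      moreover have "norm (F y - F z) - norm (g p * (y - z)) \<le> norm (F y - F z - g p * (y - z))"
        by (rule norm_triangle_ineq2)
      ultimately show "norm (y - z) \<le> 2 * norm (F y - F z)" "norm (F y - F z) \<le> 2 * norm (y - z)"
        using \<rho>(2)[OF that] norm_ge_zero[of "y - z"] unfolding gp by linarith+
    qed
    obtain t r \<Psi> \<delta> where t: "Im t = 0" "r > 0" "\<delta> > 0" "(F \<longlongrightarrow> t) (at p within \<Omega>)"
      "\<Psi> holomorphic_on ball t r \<inter> ?H"
      "\<And>w. w \<in> ball t r \<Longrightarrow> Im w > 0 \<Longrightarrow> \<Psi> w \<in> \<Omega> \<and> F (\<Psi> w) = w \<and> norm (\<Psi> w - p) \<le> 2 * norm (w - t)"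
      "\<And>z. z \<in> \<Omega> \<inter> ball p \<delta> \<Longrightarrow> F z \<in> ball t r \<and> \<Psi> (F z) = z"
      using local_boundary_inverse[OF op holF p \<rho>(1) lower upper posF bd] by metis
    show ?thesis
      using conformal_boundary_correspondence[OF op holF posF t hol \<psi> \<phi>] by metis
  qed
  obtain q where q: "q \<notin> closure \<Omega>" using smooth_domain_exterior_point[OF smooth] .
  obtain \<Phi> where hol\<Phi>: "\<Phi> holomorphic_on ?H" and inj: "inj_on \<Phi> ?H" and im: "\<Phi> ` ?H = \<Omega>"
    and \<Phi>bd: "\<And>x. Im x = 0 \<Longrightarrow> \<exists>p\<in>frontier \<Omega>. (\<Phi> \<longlongrightarrow> p) (at x within ?H)"
    using conformal_map_from_half_plane[OF op unb assms(3) q hol \<psi> \<phi> corr] by metis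
  have \<Phi>in: "\<Phi> w \<in> \<Omega>" if "Im w > 0" for w using im that by blast
  \<comment> \<open>The limit \<open>l\<close> is the same at all frontier points, so it does not
    matter which of them corresponds to \<open>x\<close>.\<close>
  have transfer: "((\<lambda>w. k (\<Phi> w)) \<longlongrightarrow> l) (at x within ?H)"
    if x: "Im x = 0" and k: "\<And>p. p \<in> frontier \<Omega> \<Longrightarrow> (k \<longlongrightarrow> l) (at p within \<Omega>)"
    for x l and k :: "complex \<Rightarrow> real"
  proof -
    obtain p where p: "p \<in> frontier \<Omega>" "(\<Phi> \<longlongrightarrow> p) (at x within ?H)"
      using \<Phi>bd[OF x] by blast
    have pn: "p \<notin> \<Omega>" using p(1) op by (simp add: frontier_def interior_open)
    have "\<forall>\<^sub>F w in at x within ?H. w \<in> ?H"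
      by (auto simp: eventually_at_topological)
    then have "\<forall>\<^sub>F w in at x within ?H. \<Phi> w \<in> \<Omega> \<and> \<Phi> w \<noteq> p"
      by eventually_elim (use \<Phi>in pn in auto)
    then have "filterlim \<Phi> (at p within \<Omega>) (at x within ?H)"
      unfolding filterlim_at using p(2) by blast
    then show ?thesis by (rule filterlim_compose[OF k[OF p(1)]])
  qed

  \<comment> \<open>The two applications of rigidity\<close>
  obtain a d where a: "a \<ge> 0" and F\<Phi>: "\<And>w. Im w > 0 \<Longrightarrow> F (\<Phi> w) = of_real a * w + of_real d"
  proof (rule half_plane_rigidity[where f = "\<lambda>w. F (\<Phi> w)" and K = 0])
    show "(\<lambda>w. F (\<Phi> w)) holomorphic_on ?H"
      by (rule holomorphic_on_compose_gen[OF hol\<Phi> holF, unfolded o_def]) (use \<Phi>in in auto)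
    show "- 0 \<le> Im (F (\<Phi> w))" if "Im w > 0" for w
      using posF[OF \<Phi>in[OF that]] by simp
    show "((\<lambda>w. Im (F (\<Phi> w))) \<longlongrightarrow> 0) (at x within ?H)" if "Im x = 0" for x
      by (rule transfer[OF that bd])
  qed (use that in blast)
  have a0: "a > 0"
    using posF[OF \<Phi>in[of \<i>]] F\<Phi>[of \<i>] by simp
  have oH: "open ?H" by (rule open_halfspace_Im_gt)
  have d\<Phi>: "(\<Phi> has_field_derivative deriv \<Phi> w) (at w)" if "Im w > 0" for w
    using holomorphic_derivI[OF hol\<Phi> oH] that by simp
  have chain: "f (\<Phi> w) * deriv \<Phi> w = of_real a" if w: "Im w > 0" for w
  proof -
    have "((\<lambda>w. F (\<Phi> w)) has_field_derivative f (\<Phi> w) * deriv \<Phi> w) (at w)"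
      by (rule DERIV_chain2[OF F[OF \<Phi>in[OF w]] d\<Phi>[OF w]])
    moreover have "((\<lambda>w. F (\<Phi> w)) has_field_derivative of_real a) (at w)"
    proof (rule has_field_derivative_transform_within_open[OF _ oH])
      show "((\<lambda>w. of_real a * w + of_real d) has_field_derivative of_real a) (at w)"
        by (auto intro!: derivative_eq_intros)
    qed (use w F\<Phi> in auto)
    ultimately show ?thesis by (rule DERIV_unique)
  qed
  \<comment> \<open>By the chain rule \<open>k\<close> is the reciprocal of
    \<open>f (\<Phi> w)\<close>. Hence
    \<open>Im (\<i> * log k) = - ln (norm (f (\<Phi> w)))\<close>, which has boundary value 0 and,
    by the gradient bound 8, is at least \<open>- ln 8\<close>.\<close>
  define k where "k w = deriv \<Phi> w / of_real a" for w
  have k: "k w \<noteq> 0" "norm (k w) = inverse (norm (f (\<Phi> w)))" "norm (f (\<Phi> w)) > 0" if "Im w > 0" for w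
  proof -
    have nz: "f (\<Phi> w) \<noteq> 0" "deriv \<Phi> w \<noteq> 0" using chain[OF that] a0 by auto
    then show "k w \<noteq> 0" "norm (f (\<Phi> w)) > 0" using a0 by (auto simp: k_def)
    have "k w = inverse (f (\<Phi> w))"
      using chain[OF that] nz a0 by (simp add: k_def field_simps)
    then show "norm (k w) = inverse (norm (f (\<Phi> w)))" by (simp add: norm_inverse)
  qed
  have holk: "k holomorphic_on ?H"
    unfolding k_def using a0 by (intro holomorphic_intros holomorphic_deriv[OF hol\<Phi> oH]) auto
  obtain l where l: "l holomorphic_on ?H" "\<And>w. w \<in> ?H \<Longrightarrow> exp (l w) = k w"
    using holomorphic_logarithm_exists[OF convex_halfspace_Im_gt oH holk, of \<i>] k(1) by auto
  have Im_l: "Im (\<i> * l w) = - ln (norm (f (\<Phi> w)))" if w: "Im w > 0" for w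
  proof -
    have "Re (l w) = ln (norm (exp (l w)))" by simp
    also have "\<dots> = - ln (norm (f (\<Phi> w)))"
      using l(2)[of w] k(2,3)[OF w] w by (simp add: ln_inverse)
    finally show ?thesis by simp
  qed
  obtain c d' where c: "c \<ge> 0" and lin: "\<And>w. Im w > 0 \<Longrightarrow> \<i> * l w = of_real c * w + of_real d'"
  proof (rule half_plane_rigidity[where f = "\<lambda>w. \<i> * l w" and K = "ln 8"])
    show "(\<lambda>w. \<i> * l w) holomorphic_on ?H" by (intro holomorphic_intros l)
    show "- ln 8 \<le> Im (\<i> * l w)" if w: "Im w > 0" for w
      using gradient_bound[OF op F posF fr bd bdf \<Phi>in[OF w]] k(3)[OF w]
      unfolding Im_l[OF w] by (simp add: ln_le_cancel_iff)
    show "((\<lambda>w. Im (\<i> * l w)) \<longlongrightarrow> 0) (at x within ?H)" if x: "Im x = 0" for x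
    proof -
      have "((\<lambda>w. norm (f (\<Phi> w))) \<longlongrightarrow> 1) (at x within ?H)"
        by (rule transfer[OF x bdf])
      then have "((\<lambda>w. - ln (norm (f (\<Phi> w)))) \<longlongrightarrow> - ln 1) (at x within ?H)"
        by (intro tendsto_intros) auto
      moreover have "\<forall>\<^sub>F w in at x within ?H. w \<in> ?H"
        by (auto simp: eventually_at_topological)
      then have "\<forall>\<^sub>F w in at x within ?H. - ln (norm (f (\<Phi> w))) = Im (\<i> * l w)"
        by eventually_elim (use Im_l in auto)
      ultimately show ?thesis
        using Lim_transform_eventually by fastforce
    qed
  qed (use that in blast)
  have deriv\<Phi>: "deriv \<Phi> w = of_real a * exp (- \<i> * (of_real c * w + of_real d'))" if w: "Im w > 0" for w
  proof -
    have "l w = - \<i> * (\<i> * l w)" by simp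
    then have "k w = exp (- \<i> * (of_real c * w + of_real d'))"
      using l(2)[of w] w unfolding lin[OF w] by simp
    then show ?thesis using a0 by (simp add: k_def field_simps)
  qed
  have c0: "c = 0"
  proof (rule exp_derivative_inj_imp_constant[OF _ inj])
    show "(\<Phi> has_field_derivative of_real a * exp (- \<i> * (of_real c * w + of_real d'))) (at w)"
      if "Im w > 0" for w
      using d\<Phi>[OF that] unfolding deriv\<Phi>[OF that] .
  qed
  define \<alpha> where "\<alpha> = of_real a * exp (- \<i> * of_real d')"
  have \<alpha>: "norm \<alpha> = a" using a0 by (simp add: \<alpha>_def norm_mult)
  have deriv\<alpha>: "deriv \<Phi> w = \<alpha>" if "Im w > 0" for w
    using deriv\<Phi>[OF that] c0 by (simp add: \<alpha>_def)
  have "\<exists>\<beta>. \<forall>w\<in>?H. \<Phi> w - \<alpha> * w = \<beta>"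
  proof (rule has_field_derivative_zero_constant)
    show "convex ?H" by (rule convex_halfspace_Im_gt)
    show "((\<lambda>w. \<Phi> w - \<alpha> * w) has_field_derivative 0) (at w within ?H)" if "w \<in> ?H" for w
    proof (rule has_field_derivative_at_within)
      have "(\<Phi> has_field_derivative \<alpha>) (at w)"
        using d\<Phi>[of w] deriv\<alpha>[of w] that by simp
      then show "((\<lambda>w. \<Phi> w - \<alpha> * w) has_field_derivative 0) (at w)"
        by (auto intro!: derivative_eq_intros)
    qed
  qed
  then obtain \<beta> where \<beta>: "\<And>w. Im w > 0 \<Longrightarrow> \<Phi> w = \<alpha> * w + \<beta>"
    by (auto simp: algebra_simps)
  have "norm (grad u z) = 1" if "z \<in> \<Omega>" for z
  proof -
    have "z \<in> \<Phi> ` ?H" using im that by simp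
    then obtain w where w: "Im w > 0" "z = \<Phi> w" by blast
    have "norm (f z) * a = a"
      using arg_cong[OF chain[OF w(1)], of norm] a0 w \<alpha> deriv\<alpha>[OF w(1)] by (simp add: norm_mult)
    then show ?thesis using a0 by (simp add: f_def norm_mult)
  qed
  moreover have "\<Omega> = (\<lambda>w. \<alpha> * w + \<beta>) ` ?H"
    unfolding im[symmetric] by (rule image_cong) (use \<beta> in auto)
  moreover have "\<alpha> \<noteq> 0" using \<alpha> a0 by auto
  ultimately show ?thesis
    using affine_image_upper_half_plane by metis
qed

end
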